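(* Let $\vec{\mathcal G}=([n],E)$ be an ergodic graph of a deterministic two-player mean-payoff game with $m=|E|$, and let the weights $(r_{ij})$ be independent absolutely continuous random variables with densities $f_{ij}$ satisfying $f_{ij}(y)\le\phi$ for all $(i,j),y$, for some $\phi>0$. Let $\delta=1/(4n(2n+1)m\phi)$. Then $$\mathbb P\bigl(\exists (\sigma,\tau)\in\Xi:\ B_\infty(r,\delta)\subseteq\mathcal P^{\sigma,\tau}\bigr)\ge 1-\frac1n,$$ where $B_\infty(r,\delta)=\{\tilde r:\|r-\tilde r\|_\infty\le\delta\}$.
   Context: Setting: directed graph $\vec{\mathcal G}=([n],E)$ without multiple edges, each vertex having an outgoing edge, $[n]=V_{\max}\uplus V_{\min}$, weights $r\in\mathbb R^E$. Ergodic equation in $(\lambda,u)$: $\lambda+u_i=\max_{(i,j)\in E}\{r_{ij}+u_j\}$ ($i\in V_{\max}$), $\lambda+u_i=\min_{(i,j)\in E}\{r_{ij}+u_j\}$ ($i\in V_{\min}$); $u$ is a bias if $(\lambda,u)$ solves it; ergodic graph: solvable for every $r$. Policies $\sigma:V_{\max}\to[n]$, $\tau:V_{\min}\to[n]$ choose outgoing edges; the pair is bias-induced if some bias makes every $\sigma(i)$ attain the max and every $\tau(i)$ attain the min. $\Xi$: pairs whose induced subgraph (each vertex keeping only its chosen edge) has exactly one directed cycle. $\mathcal P^{\sigma,\tau}$: set of $r$ for which $(\sigma,\tau)$ is the only bias-induced pair. *)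

theory Defs
  imports "HOL-Probability.Probability"
begin

text \<open>Vertices are [n] = {0..<n}; edges E are pairs; weights r :: nat \<times> nat \<Rightarrow> real
  (only values on E matter). V_min = {0..<n} - Vmax.\<close>

definition game_graph :: "nat \<Rightarrow> (nat \<times> nat) set \<Rightarrow> nat set \<Rightarrow> bool" where
  "game_graph n E Vmax \<longleftrightarrow> E \<subseteq> {0..<n} \<times> {0..<n} \<and> (\<forall>i<n. \<exists>j. (i, j) \<in> E)
     \<and> Vmax \<subseteq> {0..<n}"

definition ergodic_eq ::
  "nat \<Rightarrow> (nat \<times> nat) set \<Rightarrow> nat set \<Rightarrow> (nat \<times> nat \<Rightarrow> real) \<Rightarrow> real \<Rightarrow> (nat \<Rightarrow> real) \<Rightarrow> bool" where
  "ergodic_eq n E Vmax r lam u \<longleftrightarrow>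
     (\<forall>i\<in>{0..<n}.
        (i \<in> Vmax \<longrightarrow> lam + u i = Max {r (i, j) + u j | j. (i, j) \<in> E}) \<and>
        (i \<notin> Vmax \<longrightarrow> lam + u i = Min {r (i, j) + u j | j. (i, j) \<in> E}))"

definition ergodic_graph :: "nat \<Rightarrow> (nat \<times> nat) set \<Rightarrow> nat set \<Rightarrow> bool" where
  "ergodic_graph n E Vmax \<longleftrightarrow> (\<forall>r. \<exists>lam u. ergodic_eq n E Vmax r lam u)"

definition policy_pair ::
  "nat \<Rightarrow> (nat \<times> nat) set \<Rightarrow> nat set \<Rightarrow> (nat \<Rightarrow> nat) \<Rightarrow> (nat \<Rightarrow> nat) \<Rightarrow> bool" where
  "policy_pair n E Vmax \<sigma> \<tau> \<longleftrightarrow>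
     \<sigma> \<in> (\<Pi>\<^sub>E i\<in>Vmax. {j. (i, j) \<in> E}) \<and>
     \<tau> \<in> (\<Pi>\<^sub>E i\<in>{0..<n} - Vmax. {j. (i, j) \<in> E})"

definition bias_induced ::
  "nat \<Rightarrow> (nat \<times> nat) set \<Rightarrow> nat set \<Rightarrow> (nat \<times> nat \<Rightarrow> real) \<Rightarrow> (nat \<Rightarrow> nat) \<Rightarrow> (nat \<Rightarrow> nat) \<Rightarrow> bool" where
  "bias_induced n E Vmax r \<sigma> \<tau> \<longleftrightarrow>
     (\<exists>lam u. ergodic_eq n E Vmax r lam u \<and>
        (\<forall>i\<in>Vmax. lam + u i = r (i, \<sigma> i) + u (\<sigma> i)) \<and>
        (\<forall>i\<in>{0..<n} - Vmax. lam + u i = r (i, \<tau> i) + u (\<tau> i)))"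

definition induced_map :: "nat set \<Rightarrow> (nat \<Rightarrow> nat) \<Rightarrow> (nat \<Rightarrow> nat) \<Rightarrow> nat \<Rightarrow> nat" where
  "induced_map Vmax \<sigma> \<tau> = (\<lambda>i. if i \<in> Vmax then \<sigma> i else \<tau> i)"

text \<open>Directed cycles of a functional graph g on {0..<n}, each identified with its vertex set.\<close>
definition func_cycles :: "nat \<Rightarrow> (nat \<Rightarrow> nat) \<Rightarrow> nat set set" where
  "func_cycles n g = {C. \<exists>i\<in>{0..<n}. (\<exists>p>0. (g ^^ p) i = i) \<and> C = {(g ^^ k) i | k. True}}"

definition Xi :: "nat \<Rightarrow> (nat \<times> nat) set \<Rightarrow> nat set \<Rightarrow> ((nat \<Rightarrow> nat) \<times> (nat \<Rightarrow> nat)) set" where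
  "Xi n E Vmax = {(\<sigma>, \<tau>). policy_pair n E Vmax \<sigma> \<tau> \<and>
                    card (func_cycles n (induced_map Vmax \<sigma> \<tau>)) = 1}"

definition P_set ::
  "nat \<Rightarrow> (nat \<times> nat) set \<Rightarrow> nat set \<Rightarrow> (nat \<Rightarrow> nat) \<Rightarrow> (nat \<Rightarrow> nat) \<Rightarrow> (nat \<times> nat \<Rightarrow> real) set" where
  "P_set n E Vmax \<sigma> \<tau> = {r. bias_induced n E Vmax r \<sigma> \<tau> \<and>
      (\<forall>\<sigma>' \<tau>'. policy_pair n E Vmax \<sigma>' \<tau>' \<and> bias_induced n E Vmax r \<sigma>' \<tau>'
                 \<longrightarrow> \<sigma>' = \<sigma> \<and> \<tau>' = \<tau>)}"

definition ball_inf :: "(nat \<times> nat) set \<Rightarrow> (nat \<times> nat \<Rightarrow> real) \<Rightarrow> real \<Rightarrow> (nat \<times> nat \<Rightarrow> real) set" where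
  "ball_inf E r \<delta> = {r'. \<forall>e\<in>E. \<bar>r e - r' e\<bar> \<le> \<delta>}"

end

(* For a policy pair in Xi the mean weight of its cycle and the potentials along the paths to that
   cycle are linear in r, and so is the slack ("gap") of every edge in the ergodic equation, with
   coefficients of l1-norm at most 4 n - 2. Hence if all unused edges have gap larger than
   (4 n + 2) delta, then they keep a positive gap on the whole ball of radius delta.

   The gaps are large with high probability by an isolation argument. For almost every r no policy
   pair has two cycles of equal mean, so every bias-induced pair is in Xi and there are only
   finitely many biases up to constants; as the set of biases is connected, the bias is unique.
   When all weights but that of e are fixed, the weights of e for which some pair in Xi solves the
   equation with positive gap at e form a half-line. Its endpoint depends only on the other weights,
   and if the weight of e is not within w of it, then e is either used or has gap larger than w. *)
theory Submission
  imports Defs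
begin

section \<open>Uniqueness of the bias\<close>

text \<open>A union bound over policy pairs is too expensive, since there may be exponentially many
  of them. The proof spends one event per edge instead: \<open>m\<close> windows of length at most
  \<open>2 * w\<close> with \<open>w = (4 n + 2) \<delta>\<close>, each hit with probability at most
  \<open>2 \<phi> w\<close>, which adds up to \<open>4 (2 n + 1) m \<phi> \<delta> = 1 / n\<close>.
  Each window is determined by the other weights, so independence and the density bound are used for
  one coordinate at a time. The obstacle is that two different policy pairs get compared. The pair
  showing that an edge can still be avoided after its weight was improved by \<open>w\<close> for
  the owner of its tail need not be the pair of the given bias. Both pairs yield biases for
  \<open>r\<close>, and the large gap of one carries over to the other only because the bias is
  unique up to a constant. Finitely many candidates do not give this by themselves: any two biases
  have to be joined by a path of biases, which is built from order-theoretic fixed points.\<close>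

locale game =
  fixes n :: nat and E :: "(nat \<times> nat) set" and Vmax :: "nat set"
  assumes n_pos: "0 < n" and graph: "game_graph n E Vmax"
begin

lemma edge_less: "(i, j) \<in> E \<Longrightarrow> i < n \<and> j < n"
  using graph unfolding game_graph_def by (meson SigmaE2 atLeastLessThan_iff subsetD)

lemma finite_E: "finite E"
  by (rule finite_subset[of _ "{0..<n} \<times> {0..<n}"]) (use graph in \<open>auto simp: game_graph_def\<close>)

lemma finite_succ: "finite {j. (i, j) \<in> E}"
  by (rule finite_subset[of _ "{0..<n}"]) (use edge_less in auto)

lemma ex_succ: "i < n \<Longrightarrow> \<exists>j. (i, j) \<in> E"
  using graph by (auto simp: game_graph_def)

lemma Vmax_less: "i \<in> Vmax \<Longrightarrow> i < n"
  using graph by (auto simp: game_graph_def)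

section \<open>The Shapley operator and the uniqueness of the mean\<close>

definition shapley :: "(nat \<times> nat \<Rightarrow> real) \<Rightarrow> (nat \<Rightarrow> real) \<Rightarrow> nat \<Rightarrow> real" where
  "shapley r u i = (if i \<in> Vmax then Max {r (i, j) + u j | j. (i, j) \<in> E}
                    else Min {r (i, j) + u j | j. (i, j) \<in> E})"

text \<open>Slack of an edge, signed so that both players obey the same rule: in a solution it is
  nonnegative on every edge and zero on at least one edge out of each vertex.\<close>

definition excess :: "(nat \<times> nat \<Rightarrow> real) \<Rightarrow> real \<Rightarrow> (nat \<Rightarrow> real) \<Rightarrow> nat \<Rightarrow> nat \<Rightarrow> real" where
  "excess r lam u i j = (if i \<in> Vmax then 1 else -1) * (lam + u i - r (i, j) - u j)"

lemma finite_payoffs: "finite {r (i, j) + u j | j. (i, j) \<in> E}" for r :: "nat \<times> nat \<Rightarrow> real"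
proof -
  have "{r (i, j) + u j | j. (i, j) \<in> E} = (\<lambda>j. r (i, j) + u j) ` {j. (i, j) \<in> E}" by auto
  then show ?thesis using finite_succ by simp
qed

lemma ergodic_eq_shapley:
  "ergodic_eq n E Vmax r lam u \<longleftrightarrow> (\<forall>i<n. lam + u i = shapley r u i)"
  by (auto simp: ergodic_eq_def shapley_def)

lemma ergodic_eq_excess:
  "ergodic_eq n E Vmax r lam u \<longleftrightarrow>
     (\<forall>i<n. (\<forall>j. (i, j) \<in> E \<longrightarrow> 0 \<le> excess r lam u i j) \<and>
            (\<exists>j. (i, j) \<in> E \<and> excess r lam u i j = 0))"
proof -
  have "lam + u i = shapley r u i \<longleftrightarrow>
      (\<forall>j. (i, j) \<in> E \<longrightarrow> 0 \<le> excess r lam u i j) \<and>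
      (\<exists>j. (i, j) \<in> E \<and> excess r lam u i j = 0)" if "i < n" for i
  proof -
    let ?A = "{r (i, j) + u j | j. (i, j) \<in> E}"
    have ne: "?A \<noteq> {}" using ex_succ[OF that] by auto
    have "lam + u i = Max ?A \<longleftrightarrow> lam + u i \<in> ?A \<and> (\<forall>a\<in>?A. a \<le> lam + u i)"
      by (subst eq_commute) (rule Max_eq_iff[OF finite_payoffs ne])
    moreover have "lam + u i = Min ?A \<longleftrightarrow> lam + u i \<in> ?A \<and> (\<forall>a\<in>?A. lam + u i \<le> a)"
      by (subst eq_commute) (rule Min_eq_iff[OF finite_payoffs ne])
    ultimately show ?thesis
      by (cases "i \<in> Vmax") (auto simp: shapley_def excess_def algebra_simps)
  qed
  then show ?thesis by (auto simp: ergodic_eq_shapley)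
qed

text \<open>Monotonicity (\<open>c = 0\<close>) and compatibility with adding constants
  (\<open>u = v + c\<close>) in a single inequality. These are the only properties of the operator
  used in the fixed point arguments, so the two players need not be told apart there.\<close>

lemma shapley_le:
  assumes "i < n" and le: "\<And>j. j < n \<Longrightarrow> u j \<le> v j + c"
  shows "shapley r u i \<le> shapley r v i + c"
proof -
  let ?A = "{r (i, j) + u j | j. (i, j) \<in> E}" and ?B = "{r (i, j) + v j | j. (i, j) \<in> E}"
  have ne: "?A \<noteq> {}" "?B \<noteq> {}" using ex_succ[OF assms(1)] by auto
  have "Max ?A \<le> Max ?B + c"
  proof (rule Max.boundedI[OF finite_payoffs ne(1)])
    fix a assume "a \<in> ?A"
    then obtain j where j: "(i, j) \<in> E" "a = r (i, j) + u j" by auto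
    have "r (i, j) + v j \<le> Max ?B" using j finite_payoffs by (intro Max_ge) auto
    then show "a \<le> Max ?B + c" using le[of j] j edge_less by fastforce
  qed
  moreover have "Min ?A \<le> Min ?B + c"
  proof -
    have "Min ?B \<in> ?B" using Min_in[OF finite_payoffs ne(2)] .
    then obtain j where j: "(i, j) \<in> E" "Min ?B = r (i, j) + v j" by auto
    have "Min ?A \<le> r (i, j) + u j" using j finite_payoffs by (intro Min_le) auto
    then show ?thesis using le[of j] j edge_less by fastforce
  qed
  ultimately show ?thesis by (simp add: shapley_def)
qed

text \<open>At a vertex where \<open>v - u\<close> attains its maximum \<open>c\<close>, the bound
  \<open>v \<le> u + c\<close> is an equality, and applying the operator to it leaves exactly the
  comparison of the two constants.\<close>

lemma ergodic_eq_value_le: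
  assumes "ergodic_eq n E Vmax r lam u" "ergodic_eq n E Vmax r mu v"
  shows "mu \<le> lam"
proof -
  define c where "c = Max ((\<lambda>i. v i - u i) ` {0..<n})"
  have "c \<in> (\<lambda>i. v i - u i) ` {0..<n}"
    unfolding c_def using n_pos by (intro Max_in) auto
  then obtain i where i: "i < n" "c = v i - u i" by auto
  have "v j \<le> u j + c" if "j < n" for j
  proof -
    have "v j - u j \<le> c" unfolding c_def using that by (intro Max_ge) auto
    then show ?thesis by simp
  qed
  then have "shapley r v i \<le> shapley r u i + c" by (rule shapley_le[OF i(1)])
  moreover have "lam + u i = shapley r u i" "mu + v i = shapley r v i"
    using assms i(1) by (simp_all add: ergodic_eq_shapley)
  ultimately show ?thesis using i(2) by linarith
qed

lemma ergodic_eq_value_unique: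
  "ergodic_eq n E Vmax r lam u \<Longrightarrow> ergodic_eq n E Vmax r mu v \<Longrightarrow> mu = lam"
  using ergodic_eq_value_le by (meson order_antisym)

section \<open>Largest solutions below a given function\<close>

definition subsolutions_below ::
  "(nat \<times> nat \<Rightarrow> real) \<Rightarrow> real \<Rightarrow> (nat \<Rightarrow> real) \<Rightarrow> (nat \<Rightarrow> real) set" where
  "subsolutions_below r lam m = {w. \<forall>i<n. lam + w i \<le> shapley r w i \<and> w i \<le> m i}"

definition largest_below ::
  "(nat \<times> nat \<Rightarrow> real) \<Rightarrow> real \<Rightarrow> (nat \<Rightarrow> real) \<Rightarrow> nat \<Rightarrow> real" where
  "largest_below r lam m i = Sup ((\<lambda>w. w i) ` subsolutions_below r lam m)"

lemma largest_below_upper: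
  assumes "w \<in> subsolutions_below r lam m" "i < n"
  shows "w i \<le> largest_below r lam m i"
  unfolding largest_below_def
  by (rule cSup_upper) (use assms in \<open>auto simp: subsolutions_below_def bdd_above_def\<close>)

lemma largest_below_least:
  assumes "subsolutions_below r lam m \<noteq> {}"
    and "\<And>w. w \<in> subsolutions_below r lam m \<Longrightarrow> w i \<le> b"
  shows "largest_below r lam m i \<le> b"
  unfolding largest_below_def by (rule cSup_least) (use assms in auto)

text \<open>A Knaster-Tarski argument. The supremum \<open>?p\<close> of the subsolutions is itself
  one, so \<open>?p \<le> ?q\<close>. As \<open>m\<close> is a supersolution, one application of the
  operator stays below \<open>m\<close>, so \<open>?q\<close> is a subsolution too and
  \<open>?q \<le> ?p\<close>.\<close>

lemma largest_below_solves:
  assumes ne: "subsolutions_below r lam m \<noteq> {}"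
    and super: "\<And>i. i < n \<Longrightarrow> shapley r m i \<le> lam + m i"
  shows "ergodic_eq n E Vmax r lam (largest_below r lam m)"
proof -
  let ?p = "largest_below r lam m"
  let ?q = "\<lambda>i. shapley r ?p i - lam"
  have pm: "?p i \<le> m i" if "i < n" for i
    by (rule largest_below_least[OF ne]) (use that in \<open>auto simp: subsolutions_below_def\<close>)
  have pq: "?p i \<le> ?q i" if i: "i < n" for i
  proof (rule largest_below_least[OF ne])
    fix w assume w: "w \<in> subsolutions_below r lam m"
    have "shapley r w i \<le> shapley r ?p i + 0"
      by (rule shapley_le[OF i]) (use largest_below_upper[OF w] in simp)
    with w i show "w i \<le> ?q i" by (auto simp: subsolutions_below_def)
  qed
  have "?q \<in> subsolutions_below r lam m"
    unfolding subsolutions_below_def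
  proof (intro CollectI allI impI conjI)
    fix i assume i: "i < n"
    show "lam + ?q i \<le> shapley r ?q i"
      using shapley_le[OF i, of ?p ?q 0 r] pq by simp
    show "?q i \<le> m i"
      using shapley_le[OF i, of ?p m 0 r] pm super[OF i] by simp
  qed
  then have "?q i \<le> ?p i" if "i < n" for i using largest_below_upper that by blast
  then have "?p i = ?q i" if "i < n" for i using pq that by (meson order_antisym)
  then show ?thesis unfolding ergodic_eq_shapley by (metis add.commute diff_add_cancel)
qed

text \<open>Subtracting \<open>c\<close> turns a subsolution below \<open>m\<close> into one below
  \<open>m'\<close>. This makes the largest solution 1-Lipschitz in its upper bound, which is the
  continuity needed for a path of biases.\<close>

lemma largest_below_shift_le:
  assumes ne: "subsolutions_below r lam m \<noteq> {}" and i: "i < n"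
    and le: "\<And>j. j < n \<Longrightarrow> m j \<le> m' j + c"
  shows "largest_below r lam m i \<le> largest_below r lam m' i + c"
proof (rule largest_below_least[OF ne])
  fix w assume w: "w \<in> subsolutions_below r lam m"
  let ?w = "\<lambda>j. w j - c"
  have "?w \<in> subsolutions_below r lam m'"
    unfolding subsolutions_below_def
  proof (intro CollectI allI impI conjI)
    fix j assume j: "j < n"
    show "lam + ?w j \<le> shapley r ?w j"
    proof -
      have "shapley r w j \<le> shapley r ?w j + c" by (rule shapley_le[OF j]) simp
      moreover have "lam + w j \<le> shapley r w j" using w j by (simp add: subsolutions_below_def)
      ultimately show ?thesis by linarith
    qed
    have "w j \<le> m j" using w j by (simp add: subsolutions_below_def)
    with le[OF j] show "?w j \<le> m' j" by linarith
  qed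
  from largest_below_upper[OF this i] show "w i \<le> largest_below r lam m' i + c" by simp
qed

text \<open>The biases are connected modulo constants: the largest fixed points below
  \<open>min u (v + c)\<close> form, as \<open>c\<close> runs from \<open>- \<infinity>\<close> to \<open>\<infinity>\<close>, a 1-Lipschitz path from \<open>v\<close> to \<open>u\<close>
  (up to constants). Hence an isolated bias is the only one.\<close>
lemma isolated_bias_unique:
  assumes u: "ergodic_eq n E Vmax r lam u" and v: "ergodic_eq n E Vmax r lam v"
    and "0 < \<epsilon>"
    and iso: "\<And>w. ergodic_eq n E Vmax r lam w \<Longrightarrow>
       (\<And>i. i < n \<Longrightarrow> \<bar>(w i - w 0) - (u i - u 0)\<bar> < \<epsilon>) \<Longrightarrow>
       (\<And>i. i < n \<Longrightarrow> w i - w 0 = u i - u 0)"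
    and i: "i < n"
  shows "v i - v 0 = u i - u 0"
proof -
  define m where "m c = (\<lambda>i. min (u i) (v i + c))" for c
  define \<psi> where "\<psi> c = largest_below r lam (m c)" for c
  \<comment> \<open>The path is only needed on \<open>[-K, K]\<close>: at \<open>c = K\<close> the
    minimum is \<open>u\<close>, at \<open>c = - K\<close> it is \<open>v - K\<close>.\<close>
  define K where "K = Max ((\<lambda>i. \<bar>u i - v i\<bar>) ` {0..<n})"
  have K: "\<bar>u i - v i\<bar> \<le> K" if "i < n" for i
    unfolding K_def using that by (intro Max_ge) auto
  have vc: "lam + (v i + c) \<le> shapley r (\<lambda>i. v i + c) i" if "i < n" for i c
  proof -
    have "shapley r v i \<le> shapley r (\<lambda>i. v i + c) i + (- c)" by (rule shapley_le[OF that]) simp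
    moreover have "lam + v i = shapley r v i" using v that by (simp add: ergodic_eq_shapley)
    ultimately show ?thesis by linarith
  qed
  have ne: "subsolutions_below r lam (m c) \<noteq> {}" for c
  proof -
    \<comment> \<open>A shift of \<open>v\<close> that lies below both \<open>v + c\<close> and
      \<open>v - K\<close>, the latter being below \<open>u\<close>.\<close>
    have "(\<lambda>i. v i + min c (- K)) \<in> subsolutions_below r lam (m c)"
      unfolding subsolutions_below_def
    proof (intro CollectI allI impI conjI)
      fix i assume i: "i < n"
      show "lam + (v i + min c (- K)) \<le> shapley r (\<lambda>i. v i + min c (- K)) i" by (rule vc[OF i])
      show "v i + min c (- K) \<le> m c i" using K[OF i] by (auto simp: m_def abs_le_iff)
    qed
    then show ?thesis by blast
  qed
  \<comment> \<open>A minimum of two solutions is a supersolution, by monotonicity.\<close>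
  have super: "shapley r (m c) i \<le> lam + m c i" if "i < n" for i c
  proof -
    have "shapley r (m c) i \<le> shapley r u i + 0" "shapley r (m c) i \<le> shapley r v i + c"
      by (rule shapley_le[OF that]; simp add: m_def)+
    moreover have "lam + u i = shapley r u i" "lam + v i = shapley r v i"
      using u v that unfolding ergodic_eq_shapley by auto
    ultimately show ?thesis unfolding m_def by linarith
  qed
  have sol: "ergodic_eq n E Vmax r lam (\<psi> c)" for c
    unfolding \<psi>_def using largest_below_solves[OF ne super] .
  have \<psi>_le: "\<psi> c i \<le> m c i" if "i < n" for i c
    unfolding \<psi>_def
    by (rule largest_below_least[OF ne]) (use that in \<open>auto simp: subsolutions_below_def\<close>)
  have end_u: "\<psi> K i = u i" if "i < n" for i
  proof (rule antisym)
    show "\<psi> K i \<le> u i" using \<psi>_le[OF that, of K] by (simp add: m_def)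
    have "u \<in> subsolutions_below r lam (m K)"
      unfolding subsolutions_below_def
    proof (intro CollectI allI impI conjI)
      fix i assume i: "i < n"
      show "lam + u i \<le> shapley r u i" using u i by (simp add: ergodic_eq_shapley)
      show "u i \<le> m K i" using K[OF i] by (auto simp: m_def abs_le_iff)
    qed
    then show "u i \<le> \<psi> K i" unfolding \<psi>_def using largest_below_upper that by blast
  qed
  have end_v: "\<psi> (- K) i = v i - K" if "i < n" for i
  proof (rule antisym)
    show "\<psi> (- K) i \<le> v i - K" using \<psi>_le[OF that, of "- K"] by (simp add: m_def)
    have "(\<lambda>i. v i + (- K)) \<in> subsolutions_below r lam (m (- K))"
      unfolding subsolutions_below_def
    proof (intro CollectI allI impI conjI)
      fix i assume i: "i < n"
      show "lam + (v i + (- K)) \<le> shapley r (\<lambda>i. v i + (- K)) i" by (rule vc[OF i])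
      show "v i + (- K) \<le> m (- K) i" using K[OF i] by (auto simp: m_def abs_le_iff)
    qed
    from largest_below_upper[OF this that] show "v i - K \<le> \<psi> (- K) i" unfolding \<psi>_def by simp
  qed
  have lip: "\<psi> c i \<le> \<psi> c' i + \<bar>c - c'\<bar>" if "i < n" for i c c'
    unfolding \<psi>_def by (rule largest_below_shift_le[OF ne that]) (auto simp: m_def)
  have cont: "continuous_on UNIV (\<lambda>c. \<psi> c i)" if "i < n" for i
  proof (unfold continuous_on_iff, intro ballI allI impI)
    fix c e :: real assume "0 < e"
    have "dist (\<psi> c' i) (\<psi> c i) \<le> dist c' c" for c'
      using lip[OF that, of c c'] lip[OF that, of c' c] by (simp add: dist_real_def abs_le_iff)
    then show "\<exists>d>0. \<forall>c'\<in>UNIV. dist c' c < d \<longrightarrow> dist (\<psi> c' i) (\<psi> c i) < e"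
      using \<open>0 < e\<close> by (meson le_less_trans)
  qed
  \<comment> \<open>Distance to \<open>u\<close> modulo constants, in l1-norm. By isolation it takes
    no value strictly between 0 and \<open>\<epsilon>\<close>, so, being continuous along the path
    and 0 at \<open>K\<close>, it cannot reach \<open>\<epsilon>\<close> or more at
    \<open>- K\<close>.\<close>
  define D where "D c = (\<Sum>i<n. \<bar>(\<psi> c i - \<psi> c 0) - (u i - u 0)\<bar>)" for c
  have "continuous_on UNIV D"
    unfolding D_def using cont n_pos by (intro continuous_intros) auto
  then have contD: "continuous_on {-K..K} D" by (rule continuous_on_subset) simp
  have D_gap: "D c = 0" if "D c < \<epsilon>" for c
  proof -
    have "\<bar>(\<psi> c i - \<psi> c 0) - (u i - u 0)\<bar> < \<epsilon>" if "i < n" for i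
    proof -
      have "\<bar>(\<psi> c i - \<psi> c 0) - (u i - u 0)\<bar> \<le> D c"
        unfolding D_def using that by (intro member_le_sum) auto
      with \<open>D c < \<epsilon>\<close> show ?thesis by simp
    qed
    from iso[OF sol this] show ?thesis unfolding D_def by simp
  qed
  have "D K = 0" unfolding D_def using end_u n_pos by simp
  have "0 \<le> K" using K[OF i] by linarith
  have "D (- K) = 0"
  proof (rule ccontr)
    assume "D (- K) \<noteq> 0"
    then have "\<epsilon> \<le> D (- K)" using D_gap by force
    then obtain c where "D c = \<epsilon> / 2"
      using IVT2'[of D K "\<epsilon> / 2" "- K"] \<open>D K = 0\<close> \<open>0 < \<epsilon>\<close> \<open>0 \<le> K\<close> contD by auto
    with D_gap[of c] \<open>0 < \<epsilon>\<close> show False by auto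
  qed
  then have "\<forall>i\<in>{..<n}. \<bar>(\<psi> (-K) i - \<psi> (-K) 0) - (u i - u 0)\<bar> = 0"
    unfolding D_def by (subst (asm) sum_nonneg_eq_0_iff) auto
  then show ?thesis using i end_v n_pos by auto
qed

lemma finite_biases_unique:
  assumes fin: "finite F"
    and F: "\<And>w. ergodic_eq n E Vmax r lam w \<Longrightarrow> \<exists>f\<in>F. \<forall>i<n. w i - w 0 = f i"
    and u: "ergodic_eq n E Vmax r lam u" and v: "ergodic_eq n E Vmax r lam v" and i: "i < n"
  shows "v i - v 0 = u i - u 0"
proof -
  define dist' where "dist' f = (MAX i\<in>{..<n}. \<bar>f i - (u i - u 0)\<bar>)" for f
  \<comment> \<open>The least positive distance from \<open>u\<close> to a candidate; the inserted 1
    covers the case that there is none.\<close>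
  define \<epsilon> where "\<epsilon> = Min (insert 1 {d \<in> dist' ` F. 0 < d})"
  have dist'_ge: "\<bar>f i - (u i - u 0)\<bar> \<le> dist' f" if "i < n" for f i
    unfolding dist'_def using that by (intro Max_ge) auto
  have "0 < \<epsilon>" unfolding \<epsilon>_def using fin by (subst Min_gr_iff) auto
  show ?thesis
  proof (rule isolated_bias_unique[OF u v \<open>0 < \<epsilon>\<close> _ i])
    fix w k assume w: "ergodic_eq n E Vmax r lam w" and k: "k < n"
      and near: "\<And>i. i < n \<Longrightarrow> \<bar>(w i - w 0) - (u i - u 0)\<bar> < \<epsilon>"
    from F[OF w] obtain f where f: "f \<in> F" "\<forall>i<n. w i - w 0 = f i" by blast
    have "dist' f \<in> (\<lambda>i. \<bar>f i - (u i - u 0)\<bar>) ` {..<n}"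
      unfolding dist'_def using n_pos by (intro Max_in) auto
    then have "dist' f < \<epsilon>" using near f(2) by fastforce
    then have "\<not> 0 < dist' f"
    proof -
      have "\<epsilon> \<le> dist' f" if "0 < dist' f"
        unfolding \<epsilon>_def using f(1) fin that by (intro Min_le) auto
      with \<open>dist' f < \<epsilon>\<close> show ?thesis by linarith
    qed
    moreover have "w k - w 0 = f k" using f(2) k by blast
    ultimately show "w k - w 0 = u k - u 0" using dist'_ge[OF k, of f] by linarith
  qed
qed

section \<open>Policies with a single cycle\<close>

definition edge_map :: "(nat \<Rightarrow> nat) \<Rightarrow> bool" where
  "edge_map g \<longleftrightarrow> (\<forall>i<n. (i, g i) \<in> E)"

definition attracts :: "(nat \<Rightarrow> nat) \<Rightarrow> nat \<Rightarrow> bool" where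
  "attracts g c \<longleftrightarrow> c < n \<and> (\<forall>i<n. \<exists>d. (g ^^ d) i = c)"

text \<open>Encodes the single cycle by reachability. A vertex reached from everywhere, in
  particular from its own successor, lies on a cycle, and no other cycle can reach it. This form
  supplies a root towards which paths can be measured.\<close>

definition unicyclic :: "(nat \<Rightarrow> nat) \<Rightarrow> bool" where
  "unicyclic g \<longleftrightarrow> edge_map g \<and> (\<exists>c. attracts g c)"

definition root :: "(nat \<Rightarrow> nat) \<Rightarrow> nat" where
  "root g = (SOME c. attracts g c)"

definition hops :: "(nat \<Rightarrow> nat) \<Rightarrow> nat \<Rightarrow> nat" where
  "hops g i = (LEAST d. (g ^^ d) i = root g)"

definition path_weight :: "(nat \<Rightarrow> nat) \<Rightarrow> (nat \<times> nat \<Rightarrow> real) \<Rightarrow> nat \<Rightarrow> real" where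
  "path_weight g r i = (\<Sum>k<hops g i. r ((g ^^ k) i, g ((g ^^ k) i)))"

text \<open>Since \<open>hops\<close> vanishes at the root, going once around the cycle is written
  as the edge leaving the root followed by the path back from its successor.\<close>

definition cycle_mean :: "(nat \<Rightarrow> nat) \<Rightarrow> (nat \<times> nat \<Rightarrow> real) \<Rightarrow> real" where
  "cycle_mean g r =
     (r (root g, g (root g)) + path_weight g r (g (root g))) / (1 + real (hops g (g (root g))))"

definition potential :: "(nat \<Rightarrow> nat) \<Rightarrow> (nat \<times> nat \<Rightarrow> real) \<Rightarrow> nat \<Rightarrow> real" where
  "potential g r i = path_weight g r i - real (hops g i) * cycle_mean g r"

definition gap :: "(nat \<Rightarrow> nat) \<Rightarrow> (nat \<times> nat \<Rightarrow> real) \<Rightarrow> nat \<Rightarrow> nat \<Rightarrow> real" where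
  "gap g r i j = excess r (cycle_mean g r) (potential g r) i j"

lemma edge_map_less: "edge_map g \<Longrightarrow> i < n \<Longrightarrow> g i < n"
  using edge_less by (auto simp: edge_map_def)

lemma edge_map_funpow_less: "edge_map g \<Longrightarrow> i < n \<Longrightarrow> (g ^^ k) i < n"
  by (induction k) (auto intro: edge_map_less)

lemma attracts_root: "unicyclic g \<Longrightarrow> attracts g (root g)"
  unfolding root_def unicyclic_def by (meson someI_ex)

lemma root_less: "unicyclic g \<Longrightarrow> root g < n"
  using attracts_root attracts_def by blast

lemma unicyclic_less: "unicyclic g \<Longrightarrow> i < n \<Longrightarrow> g i < n"
  using edge_map_less unicyclic_def by blast

lemma hops_root [simp]: "hops g (root g) = 0"
  unfolding hops_def by (rule Least_eq_0) simp

lemma path_weight_root [simp]: "path_weight g r (root g) = 0"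
  by (simp add: path_weight_def)

lemma hops_step:
  assumes "unicyclic g" "i < n" "i \<noteq> root g"
  shows "hops g i = Suc (hops g (g i))"
proof -
  obtain d where d: "(g ^^ d) i = root g"
    using attracts_root[OF assms(1)] assms(2) by (auto simp: attracts_def)
  have "(LEAST d. (g ^^ d) i = root g) = Suc (LEAST d. (g ^^ Suc d) i = root g)"
    by (rule Least_Suc[where P = "\<lambda>d. (g ^^ d) i = root g", OF d]) (use assms(3) in simp)
  then show ?thesis unfolding hops_def by (simp add: funpow_swap1)
qed

lemma hops_induct [consumes 2, case_names root step]:
  assumes "unicyclic g" "i < n" "P (root g)"
    and "\<And>i. i < n \<Longrightarrow> i \<noteq> root g \<Longrightarrow> P (g i) \<Longrightarrow> P i"
  shows "P i"
  using assms(2)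
proof (induction "hops g i" arbitrary: i rule: less_induct)
  case less
  show ?case
  proof (cases "i = root g")
    case False
    then have "P (g i)" using less hops_step[OF assms(1)] unicyclic_less[OF assms(1)] by simp
    then show ?thesis using assms(4) less.prems False by blast
  qed (use assms(3) in simp)
qed

text \<open>On the way to the root \<open>hops\<close> falls by one at each step, so it takes all
  values from \<open>hops g i\<close> to 0, and there are only \<open>n\<close> vertices to take
  them.\<close>

lemma hops_less:
  assumes "unicyclic g" "i < n"
  shows "hops g i < n"
proof -
  have "{..hops g i} \<subseteq> hops g ` {..<n}"
    using assms
  proof (induction rule: hops_induct)
    case root
    have "0 \<in> hops g ` {..<n}" using root_less[OF assms(1)] by (intro image_eqI[of _ _ "root g"]) auto
    then show ?case by simp
  next
    case (step i)
    have "{..hops g i} = insert (hops g i) {..hops g (g i)}"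
      using hops_step[OF assms(1) step(1,2)] by auto
    with step show ?case by auto
  qed
  then have "card {..hops g i} \<le> card (hops g ` {..<n})" by (intro card_mono) auto
  also have "\<dots> \<le> n" using card_image_le[of "{..<n}"] by simp
  finally show ?thesis by simp
qed

lemma path_weight_step:
  assumes "unicyclic g" "i < n" "i \<noteq> root g"
  shows "path_weight g r i = r (i, g i) + path_weight g r (g i)"
  unfolding path_weight_def hops_step[OF assms] sum.lessThan_Suc_shift
  by (simp add: funpow_swap1)

text \<open>Away from the root this is telescoping. At the root, where the potential is 0, it is the
  definition of the mean.\<close>

lemma potential_step:
  assumes "unicyclic g" "i < n"
  shows "cycle_mean g r + potential g r i = r (i, g i) + potential g r (g i)"
proof (cases "i = root g")
  case True
  have "(1 + real (hops g (g (root g)))) * cycle_mean g r =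
      r (root g, g (root g)) + path_weight g r (g (root g))"
    unfolding cycle_mean_def by simp
  then show ?thesis unfolding True by (simp add: potential_def algebra_simps)
next
  case False
  show ?thesis
    unfolding potential_def path_weight_step[OF assms False] hops_step[OF assms False]
    by (simp add: algebra_simps)
qed

text \<open>Unrolling the equation down to the root fixes \<open>u\<close> up to its value there;
  closing the cycle at the root then fixes \<open>lam\<close>.\<close>

lemma potential_unique:
  assumes g: "unicyclic g" and eq: "\<And>i. i < n \<Longrightarrow> lam + u i = r (i, g i) + u (g i)"
  shows "lam = cycle_mean g r" and "i < n \<Longrightarrow> u i = u (root g) + potential g r i"
proof -
  have pw: "u i = u (root g) + path_weight g r i - real (hops g i) * lam" if "i < n" for i
    using g that
  proof (induction rule: hops_induct)
    case (step i)
    then show ?case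
      using eq[OF step(1)] hops_step[OF g step(1,2)] path_weight_step[OF g step(1,2), of r]
      by (simp add: algebra_simps)
  qed simp
  have "lam * (1 + real (hops g (g (root g)))) =
      r (root g, g (root g)) + path_weight g r (g (root g))"
    using eq[OF root_less[OF g]] pw[OF unicyclic_less[OF g root_less[OF g]]]
    by (simp add: algebra_simps)
  then show lam: "lam = cycle_mean g r"
    unfolding cycle_mean_def by (simp add: eq_divide_eq)
  show "u i = u (root g) + potential g r i" if "i < n"
    using pw[OF that] unfolding lam potential_def by simp
qed

lemma gap_self:
  "unicyclic g \<Longrightarrow> i < n \<Longrightarrow> gap g r i (g i) = 0"
  using potential_step[of g i r] by (simp add: gap_def excess_def)

text \<open>Slacks see only differences of \<open>u\<close>, so any solution that is tight along
  \<open>g\<close> has the slacks computed from the potential.\<close>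

lemma gap_eq_excess:
  assumes g: "unicyclic g" and eq: "\<And>i. i < n \<Longrightarrow> excess r lam u i (g i) = 0"
    and e: "(i, j) \<in> E"
  shows "gap g r i j = excess r lam u i j"
proof -
  have "lam + u i = r (i, g i) + u (g i)" if "i < n" for i
    using eq[OF that] by (auto simp: excess_def split: if_splits)
  from potential_unique[OF g, of lam u r, OF this] edge_less[OF e]
  show ?thesis by (simp add: gap_def excess_def)
qed

lemma ergodic_eq_gap:
  assumes g: "unicyclic g" and "\<And>i j. (i, j) \<in> E \<Longrightarrow> 0 \<le> gap g r i j"
  shows "ergodic_eq n E Vmax r (cycle_mean g r) (potential g r)"
  unfolding ergodic_eq_excess
  using assms gap_self[OF g, of _ r] unfolding gap_def unicyclic_def edge_map_def by blast

section \<open>Gaps as linear forms, measured in the l1-norm dual to the sup-norm of the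
  ball\<close>

definition lin :: "real \<Rightarrow> ((nat \<times> nat \<Rightarrow> real) \<Rightarrow> real) \<Rightarrow> bool" where
  "lin K L \<longleftrightarrow> (\<exists>a. (\<forall>r. L r = (\<Sum>e\<in>E. a e * r e)) \<and> (\<Sum>e\<in>E. \<bar>a e\<bar>) \<le> K)"

lemma lin_zero: "lin 0 (\<lambda>r. 0)"
  unfolding lin_def by (rule exI[of _ "\<lambda>_. 0"]) simp

lemma lin_edge: "e \<in> E \<Longrightarrow> lin 1 (\<lambda>r. r e)"
  unfolding lin_def using finite_E
  by (intro exI[of _ "\<lambda>e'. if e' = e then 1 else 0"])
     (simp add: if_distrib[of abs] if_distrib[of "\<lambda>x. x * _"] cong: if_cong)

lemma lin_add:
  assumes "lin K L" "lin K' L'"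
  shows "lin (K + K') (\<lambda>r. L r + L' r)"
proof -
  obtain a a' where a: "\<And>r. L r = (\<Sum>e\<in>E. a e * r e)" "(\<Sum>e\<in>E. \<bar>a e\<bar>) \<le> K"
    and a': "\<And>r. L' r = (\<Sum>e\<in>E. a' e * r e)" "(\<Sum>e\<in>E. \<bar>a' e\<bar>) \<le> K'"
    using assms unfolding lin_def by blast
  have "(\<Sum>e\<in>E. \<bar>a e + a' e\<bar>) \<le> (\<Sum>e\<in>E. \<bar>a e\<bar>) + (\<Sum>e\<in>E. \<bar>a' e\<bar>)"
    unfolding sum.distrib[symmetric] by (intro sum_mono abs_triangle_ineq)
  then show ?thesis
    unfolding lin_def using a(2) a'(2)
    by (intro exI[of _ "\<lambda>e. a e + a' e"]) (simp add: a(1) a'(1) sum.distrib distrib_right)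
qed

lemma lin_scale:
  assumes "lin K L"
  shows "lin (\<bar>c\<bar> * K) (\<lambda>r. c * L r)"
proof -
  obtain a where a: "\<And>r. L r = (\<Sum>e\<in>E. a e * r e)" "(\<Sum>e\<in>E. \<bar>a e\<bar>) \<le> K"
    using assms unfolding lin_def by blast
  have "(\<Sum>e\<in>E. \<bar>c * a e\<bar>) = \<bar>c\<bar> * (\<Sum>e\<in>E. \<bar>a e\<bar>)"
    by (simp add: abs_mult sum_distrib_left)
  then have "(\<Sum>e\<in>E. \<bar>c * a e\<bar>) \<le> \<bar>c\<bar> * K" using a(2) by (simp add: mult_left_mono)
  then show ?thesis
    unfolding lin_def
    by (intro exI[of _ "\<lambda>e. c * a e"]) (simp add: a(1) sum_distrib_left mult.assoc)
qed

lemma lin_diff: "lin K L \<Longrightarrow> lin K' L' \<Longrightarrow> lin (K + K') (\<lambda>r. L r - L' r)"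
  using lin_add[of K L K' "\<lambda>r. - 1 * L' r"] lin_scale[of K' L' "- 1"] by simp

lemma lin_mono: "lin K L \<Longrightarrow> K \<le> K' \<Longrightarrow> lin K' L"
  unfolding lin_def by force

lemma lin_path_weight:
  assumes g: "unicyclic g" and "i < n"
  shows "lin (real (hops g i)) (\<lambda>r. path_weight g r i)"
  using assms
proof (induction rule: hops_induct)
  case root
  then show ?case by (simp add: lin_zero)
next
  case (step i)
  have "(i, g i) \<in> E" using g step(1) by (simp add: unicyclic_def edge_map_def)
  from lin_add[OF lin_edge[OF this] step(3)] show ?case
    using hops_step[OF g step(1,2)] path_weight_step[OF g step(1,2)] by simp
qed

lemma lin_cycle_mean:
  assumes g: "unicyclic g"
  shows "lin 1 (cycle_mean g)"
proof -
  let ?c = "root g"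
  let ?h = "real (hops g (g ?c))"
  have "(?c, g ?c) \<in> E" using g root_less[OF g] by (simp add: unicyclic_def edge_map_def)
  from lin_scale[OF lin_add[OF lin_edge[OF this]
        lin_path_weight[OF g unicyclic_less[OF g root_less[OF g]]]], of "1 / (1 + ?h)"]
  show ?thesis by (simp add: cycle_mean_def[abs_def])
qed

lemma lin_potential:
  assumes g: "unicyclic g" and i: "i < n"
  shows "lin (2 * real (n - 1)) (\<lambda>r. potential g r i)"
proof -
  have "lin (real (hops g i) + \<bar>real (hops g i)\<bar> * 1) (\<lambda>r. potential g r i)"
    unfolding potential_def
    by (intro lin_diff lin_path_weight[OF g i] lin_scale[OF lin_cycle_mean[OF g]])
  then show ?thesis using hops_less[OF g i] by (elim lin_mono) simp
qed

text \<open>The mean and the edge weight contribute 1 each, the two potentials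
  \<open>2 (n - 1)\<close> each: in total \<open>4 n - 2\<close>.\<close>

lemma lin_gap:
  assumes g: "unicyclic g" and e: "(i, j) \<in> E"
  shows "lin (4 * real n - 2) (\<lambda>r. gap g r i j)"
proof -
  let ?s = "if i \<in> Vmax then 1 else - 1 :: real"
  have "lin (\<bar>?s\<bar> * (1 + 2 * real (n - 1) + 1 + 2 * real (n - 1))) (\<lambda>r. gap g r i j)"
    unfolding gap_def excess_def using edge_less[OF e]
    by (intro lin_scale lin_add lin_diff lin_cycle_mean[OF g] lin_potential[OF g] lin_edge[OF e])
       simp_all
  then show ?thesis using n_pos by (elim lin_mono) (simp add: of_nat_diff)
qed

text \<open>The edges used by \<open>g\<close> determine mean and potential, so the weight of an unused edge
  enters only its own gap.\<close>
lemma gap_upd: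
  assumes g: "unicyclic g" and e: "(i, j) \<in> E" and e': "e' = (i', j')" "g i' \<noteq> j'"
  shows "gap g (r(e' := x)) i j =
    gap g r i j - (if (i, j) = e' then (if i \<in> Vmax then 1 else -1) * (x - r e') else 0)"
proof -
  let ?r = "r(e' := x)"
  have eq: "cycle_mean g r + potential g r k = ?r (k, g k) + potential g r (g k)" if "k < n" for k
    using potential_step[OF g that, of r] e' by auto
  have "excess ?r (cycle_mean g r) (potential g r) k (g k) = 0" if "k < n" for k
    using eq[OF that] by (simp add: excess_def)
  from gap_eq_excess[OF g this e] show ?thesis
    by (auto simp: gap_def excess_def)
qed

section \<open>Cycles of functional graphs\<close>

lemma eventually_periodic:
  assumes "edge_map g" "i < n"
  shows "\<exists>a p. p > 0 \<and> (g ^^ p) ((g ^^ a) i) = (g ^^ a) i"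
proof -
  have "range (\<lambda>k. (g ^^ k) i) \<subseteq> {..<n}" using edge_map_funpow_less[OF assms] by auto
  then have "finite (range (\<lambda>k. (g ^^ k) i))" using finite_subset by blast
  then have "\<not> inj (\<lambda>k. (g ^^ k) i)" using finite_imageD by fastforce
  then obtain a b where "(g ^^ a) i = (g ^^ b) i" "a < b"
    unfolding inj_def by (metis linorder_neqE_nat)
  then have "(g ^^ (b - a)) ((g ^^ a) i) = (g ^^ a) i"
    by (metis add_diff_inverse_nat comp_apply funpow_add add.commute not_less_iff_gr_or_eq)
  with \<open>a < b\<close> show ?thesis by (metis zero_less_diff)
qed

lemma orbit_mem_cycles:
  assumes "edge_map g" "i < n" "p > 0" "(g ^^ p) i = i"
  shows "{(g ^^ k) i | k. True} \<in> func_cycles n g"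
  using assms unfolding func_cycles_def by auto

lemma func_cycles_ne: "edge_map g \<Longrightarrow> func_cycles n g \<noteq> {}"
  using eventually_periodic[OF _ n_pos] orbit_mem_cycles edge_map_funpow_less[OF _ n_pos] by blast

text \<open>Every vertex runs into some cycle; that cycle must be \<open>C\<close>, and following it
  leads to any chosen point \<open>c\<close> of \<open>C\<close>.\<close>

lemma unicyclic_if_card:
  assumes g: "edge_map g" and "card (func_cycles n g) = 1"
  shows "unicyclic g"
proof -
  obtain C where C: "func_cycles n g = {C}" using assms(2) card_1_singletonE by blast
  then have "C \<in> func_cycles n g" by simp
  then obtain c where c: "c < n" "C = {(g ^^ k) c | k. True}"
    unfolding func_cycles_def by auto
  have "c \<in> C" using c(2) by (auto intro: exI[of _ 0])
  have "\<exists>d. (g ^^ d) i = c" if i: "i < n" for i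
  proof -
    obtain a p where p: "p > 0" "(g ^^ p) ((g ^^ a) i) = (g ^^ a) i"
      using eventually_periodic[OF g i] by blast
    have "{(g ^^ k) ((g ^^ a) i) | k. True} \<in> func_cycles n g"
      by (rule orbit_mem_cycles[OF g edge_map_funpow_less[OF g i] p])
    then have "c \<in> {(g ^^ k) ((g ^^ a) i) | k. True}" using C \<open>c \<in> C\<close> by auto
    then obtain k where "(g ^^ k) ((g ^^ a) i) = c" by auto
    then have "(g ^^ (k + a)) i = c" by (simp add: funpow_add)
    then show ?thesis ..
  qed
  then show ?thesis using g c(1) unfolding unicyclic_def attracts_def by blast
qed

lemma cycle_props:
  assumes g: "edge_map g" and C: "C \<in> func_cycles n g"
  shows "C \<subseteq> {..<n}" "C \<noteq> {}" "bij_betw g C C"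
proof -
  obtain i p where i: "i < n" "p > 0" "(g ^^ p) i = i" "C = {(g ^^ k) i | k. True}"
    using C unfolding func_cycles_def by auto
  show sub: "C \<subseteq> {..<n}" using i edge_map_funpow_less[OF g i(1)] by auto
  show "C \<noteq> {}" using i by auto
  have "g ` C = C"
  proof
    show "g ` C \<subseteq> C"
      unfolding i(4) by clarify (metis comp_apply funpow.simps(2))
    show "C \<subseteq> g ` C"
    proof
      fix x assume "x \<in> C"
      then obtain k where x: "x = (g ^^ k) i" using i(4) by auto
      obtain q where p: "p = Suc q" using i(2) gr0_implies_Suc by blast
      have "x = (g ^^ k) ((g ^^ p) i)" using i(3) x by simp
      also have "\<dots> = (g ^^ (k + p)) i" by (simp add: funpow_add)
      also have "\<dots> = g ((g ^^ (k + q)) i)" by (simp add: p)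
      finally show "x \<in> g ` C" using i(4) by blast
    qed
  qed
  moreover have "finite C" using sub finite_subset by blast
  ultimately show "bij_betw g C C" unfolding bij_betw_def by (simp add: eq_card_imp_inj_on)
qed

text \<open>A cycle is generated by any of its vertices, hence distinct cycles are disjoint; this is
  what separates their weights later.\<close>

lemma cycle_eq_orbit:
  assumes C: "C \<in> func_cycles n g" and x: "x \<in> C"
  shows "C = {(g ^^ k) x | k. True}"
proof -
  obtain i p where i: "p > 0" "(g ^^ p) i = i" "C = {(g ^^ k) i | k. True}"
    using C unfolding func_cycles_def by auto
  obtain a where a: "x = (g ^^ a) i" using x i(3) by auto
  have fix_i: "(g ^^ (a * p)) i = i"
    using i(2) by (induction a) (simp_all add: funpow_add)
  \<comment> \<open>\<open>a * p\<close> is a multiple of the period that is at least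
    \<open>a\<close>, so \<open>a * p - a\<close> further steps lead from \<open>x\<close> back to
    \<open>i\<close>.\<close>
  have "a \<le> a * p" using i(1) by simp
  then have "(g ^^ (a * p - a)) x = i"
    using fix_i unfolding a by (simp add: funpow_add[symmetric, THEN fun_cong, unfolded comp_apply])
  then have "(g ^^ k) i = (g ^^ (k + (a * p - a))) x" for k by (simp add: funpow_add)
  moreover have "(g ^^ k) x = (g ^^ (k + a)) i" for k unfolding a by (simp add: funpow_add)
  ultimately show ?thesis unfolding i(3) by blast
qed

text \<open>Summed over the cycle, which \<open>g\<close> permutes, the terms in \<open>u\<close>
  cancel: every cycle used by a bias has mean \<open>lam\<close>.\<close>

lemma cycle_weight:
  assumes g: "edge_map g" and C: "C \<in> func_cycles n g"
    and eq: "\<And>i. i < n \<Longrightarrow> lam + u i = r (i, g i) + u (g i)"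
  shows "(\<Sum>i\<in>C. r (i, g i)) = real (card C) * lam"
proof -
  have "(\<Sum>i\<in>C. u (g i)) = (\<Sum>i\<in>C. u i)"
    using sum.reindex_bij_betw[OF cycle_props(3)[OF g C]] .
  moreover have "(\<Sum>i\<in>C. lam + u i) = (\<Sum>i\<in>C. r (i, g i) + u (g i))"
    using cycle_props(1)[OF g C] by (intro sum.cong refl eq) auto
  ultimately show ?thesis by (simp add: sum.distrib)
qed

section \<open>Generic weights\<close>

abbreviation joint :: "(nat \<Rightarrow> nat) \<Rightarrow> (nat \<Rightarrow> nat) \<Rightarrow> nat \<Rightarrow> nat" where
  "joint \<sigma> \<tau> \<equiv> induced_map Vmax \<sigma> \<tau>"

abbreviation side :: "nat \<Rightarrow> real" where
  "side i \<equiv> (if i \<in> Vmax then 1 else -1)"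

lemma policy_edge_map: "policy_pair n E Vmax \<sigma> \<tau> \<Longrightarrow> edge_map (joint \<sigma> \<tau>)"
  by (auto simp: policy_pair_def edge_map_def induced_map_def dest!: PiE_mem)

lemma Xi_policy: "(\<sigma>, \<tau>) \<in> Xi n E Vmax \<Longrightarrow> policy_pair n E Vmax \<sigma> \<tau>"
  by (simp add: Xi_def)

lemma Xi_unicyclic: "(\<sigma>, \<tau>) \<in> Xi n E Vmax \<Longrightarrow> unicyclic (joint \<sigma> \<tau>)"
  by (intro unicyclic_if_card policy_edge_map) (auto simp: Xi_def)

lemma finite_policies: "finite {(\<sigma>, \<tau>). policy_pair n E Vmax \<sigma> \<tau>}"
proof -
  have "finite Vmax" by (rule finite_subset[of _ "{0..<n}"]) (use Vmax_less in auto)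
  then have "finite ((\<Pi>\<^sub>E i\<in>Vmax. {j. (i, j) \<in> E}) \<times> (\<Pi>\<^sub>E i\<in>{0..<n} - Vmax. {j. (i, j) \<in> E}))"
    using finite_succ by (intro finite_cartesian_product finite_PiE) auto
  then show ?thesis by (rule rev_finite_subset) (auto simp: policy_pair_def)
qed

lemma finite_Xi: "finite (Xi n E Vmax)"
  by (rule finite_subset[OF _ finite_policies]) (auto simp: Xi_def)

lemma policy_of_edge_map:
  assumes "edge_map h"
  obtains \<sigma> \<tau> where "policy_pair n E Vmax \<sigma> \<tau>" "\<And>i. i < n \<Longrightarrow> joint \<sigma> \<tau> i = h i"
proof
  show "policy_pair n E Vmax (restrict h Vmax) (restrict h ({0..<n} - Vmax))"
    using assms Vmax_less by (auto simp: policy_pair_def edge_map_def)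
  show "joint (restrict h Vmax) (restrict h ({0..<n} - Vmax)) i = h i" if "i < n" for i
    using that by (simp add: induced_map_def)
qed

lemma policy_eqI:
  assumes "policy_pair n E Vmax \<sigma> \<tau>" "policy_pair n E Vmax \<sigma>' \<tau>'"
    and eq: "\<And>i. i < n \<Longrightarrow> joint \<sigma>' \<tau>' i = joint \<sigma> \<tau> i"
  shows "\<sigma>' = \<sigma> \<and> \<tau>' = \<tau>"
proof
  have "\<sigma>' i = \<sigma> i" if "i \<in> Vmax" for i
    using eq[OF Vmax_less[OF that]] that by (simp add: induced_map_def)
  then show "\<sigma>' = \<sigma>" using assms(1,2) unfolding policy_pair_def by (blast intro: PiE_ext)
  have "\<tau>' i = \<tau> i" if "i \<in> {0..<n} - Vmax" for i
    using eq[of i] that by (simp add: induced_map_def)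
  then show "\<tau>' = \<tau>" using assms(1,2) unfolding policy_pair_def by (blast intro: PiE_ext)
qed

section \<open>Strict gaps characterise \<open>P_set\<close>\<close>

lemma bias_induced_excess:
  "bias_induced n E Vmax r \<sigma> \<tau> \<longleftrightarrow>
     (\<exists>lam u. ergodic_eq n E Vmax r lam u \<and> (\<forall>i<n. excess r lam u i (joint \<sigma> \<tau> i) = 0))"
proof -
  have "(\<forall>i\<in>Vmax. lam + u i = r (i, \<sigma> i) + u (\<sigma> i)) \<and>
        (\<forall>i\<in>{0..<n} - Vmax. lam + u i = r (i, \<tau> i) + u (\<tau> i)) \<longleftrightarrow>
        (\<forall>i<n. excess r lam u i (joint \<sigma> \<tau> i) = 0)" (is "?L \<longleftrightarrow> ?R") for lam u
  proof
    assume ?L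
    then show ?R by (auto simp: excess_def induced_map_def)
  next
    assume R: ?R
    show ?L
    proof (intro conjI ballI)
      fix i assume i: "i \<in> Vmax"
      show "lam + u i = r (i, \<sigma> i) + u (\<sigma> i)"
        using R[rule_format, OF Vmax_less[OF i]] i by (simp add: excess_def induced_map_def)
    next
      fix i assume "i \<in> {0..<n} - Vmax"
      then show "lam + u i = r (i, \<tau> i) + u (\<tau> i)"
        using R[rule_format, of i] by (simp add: excess_def induced_map_def)
    qed
  qed
  then show ?thesis unfolding bias_induced_def by auto
qed

lemma strict_gap_bias_unique:
  assumes g: "unicyclic g" and strict: "\<And>i j. (i, j) \<in> E \<Longrightarrow> j \<noteq> g i \<Longrightarrow> 0 < gap g r i j"
    and v: "ergodic_eq n E Vmax r lam v" and e: "(i, j) \<in> E"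
  shows "excess r lam v i j = gap g r i j"
proof -
  let ?p = "potential g r"
  \<comment> \<open>Half the least gap (capped by 1), because a slack involves two vertices whose
    normalised values move by less than \<open>\<epsilon>\<close> each.\<close>
  define \<epsilon> where "\<epsilon> = Min (insert 1 ((\<lambda>(i, j). gap g r i j) ` {(i, j) \<in> E. j \<noteq> g i})) / 2"
  have fin: "finite {(i, j) \<in> E. j \<noteq> g i}" using finite_E by (rule rev_finite_subset) auto
  have "0 < \<epsilon>" unfolding \<epsilon>_def using fin strict by (auto simp: Min_gr_iff)
  have \<epsilon>: "2 * \<epsilon> \<le> gap g r i j" if "(i, j) \<in> E" "j \<noteq> g i" for i j
  proof -
    have "gap g r i j \<in> (\<lambda>(i, j). gap g r i j) ` {(i, j) \<in> E. j \<noteq> g i}"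
      using that by (intro image_eqI[of _ _ "(i, j)"]) auto
    then show ?thesis unfolding \<epsilon>_def using fin by (simp add: Min_le)
  qed
  have "0 \<le> gap g r i j" if "(i, j) \<in> E" for i j
    using strict[OF that] gap_self[OF g, of i r] edge_less[OF that]
    by (cases "j = g i") (auto simp: less_imp_le)
  then have p: "ergodic_eq n E Vmax r (cycle_mean g r) ?p" by (rule ergodic_eq_gap[OF g])
  have lam: "lam = cycle_mean g r" using ergodic_eq_value_unique[OF p v] .
  have uniq: "v i - v 0 = ?p i - ?p 0" if "i < n" for i
  proof (rule isolated_bias_unique[OF p v[unfolded lam] \<open>0 < \<epsilon>\<close> _ that])
    fix w k assume w: "ergodic_eq n E Vmax r (cycle_mean g r) w" and k: "k < n"
      and near: "\<And>i. i < n \<Longrightarrow> \<bar>(w i - w 0) - (?p i - ?p 0)\<bar> < \<epsilon>"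
    have sat: "cycle_mean g r + w i = r (i, g i) + w (g i)" if i: "i < n" for i
    proof -
      obtain j where j: "(i, j) \<in> E" "excess r (cycle_mean g r) w i j = 0"
        using w i unfolding ergodic_eq_excess by blast
      have "j = g i"
      proof (rule ccontr)
        assume "j \<noteq> g i"
        have "\<bar>(w i - w j) - (?p i - ?p j)\<bar> < 2 * \<epsilon>"
          using near[of i] near[of j] edge_less[OF j(1)] by linarith
        then show False using \<epsilon>[OF j(1) \<open>j \<noteq> g i\<close>] j(2)
          by (auto simp: gap_def excess_def split: if_splits)
      qed
      then show ?thesis using j(2) by (auto simp: excess_def split: if_splits)
    qed
    show "w k - w 0 = ?p k - ?p 0"
      using potential_unique(2)[OF g, of _ w r, OF sat k]
        potential_unique(2)[OF g, of _ w r, OF sat n_pos] by simp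
  qed
  have "v i - v j = ?p i - ?p j" using uniq[of i] uniq[of j] edge_less[OF e] by linarith
  then show ?thesis unfolding lam gap_def excess_def by (simp add: algebra_simps)
qed

lemma P_set_gap:
  assumes Xi: "(\<sigma>, \<tau>) \<in> Xi n E Vmax"
  shows "r \<in> P_set n E Vmax \<sigma> \<tau> \<longleftrightarrow>
    (\<forall>i j. (i, j) \<in> E \<longrightarrow> j \<noteq> joint \<sigma> \<tau> i \<longrightarrow> 0 < gap (joint \<sigma> \<tau>) r i j)" (is "?L \<longleftrightarrow> ?R")
proof
  let ?g = "joint \<sigma> \<tau>"
  have g: "unicyclic ?g" using Xi_unicyclic[OF Xi] .
  have edge: "edge_map ?g" using g unicyclic_def by blast
  {
    assume L: ?L
    then obtain lam u where u: "ergodic_eq n E Vmax r lam u"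
      and sat: "\<And>i. i < n \<Longrightarrow> excess r lam u i (?g i) = 0"
      unfolding P_set_def bias_induced_excess by blast
    show ?R
    proof (intro allI impI)
      fix i j assume e: "(i, j) \<in> E" and ne: "j \<noteq> ?g i"
      have i: "i < n" using edge_less[OF e] by simp
      have "excess r lam u i j \<noteq> 0"
      proof
        assume 0: "excess r lam u i j = 0"
        have "edge_map (?g(i := j))" using edge e by (simp add: edge_map_def)
        then obtain \<sigma>' \<tau>' where p: "policy_pair n E Vmax \<sigma>' \<tau>'"
          and eq: "\<And>k. k < n \<Longrightarrow> joint \<sigma>' \<tau>' k = (?g(i := j)) k"
          by (rule policy_of_edge_map) blast
        have "bias_induced n E Vmax r \<sigma>' \<tau>'"
          unfolding bias_induced_excess using u sat 0 eq by (metis fun_upd_apply)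
        then have "\<sigma>' = \<sigma> \<and> \<tau>' = \<tau>" using L p unfolding P_set_def by blast
        then show False using eq[OF i] ne by simp
      qed
      moreover have "0 \<le> excess r lam u i j" using u i e unfolding ergodic_eq_excess by blast
      ultimately show "0 < gap ?g r i j"
        using gap_eq_excess[OF g sat e] by simp
    qed
  }
  {
    assume R: ?R
    have "0 \<le> gap ?g r i j" if "(i, j) \<in> E" for i j
      using R[rule_format, OF that] gap_self[OF g, of i r] edge_less[OF that]
      by (cases "j = ?g i") (auto simp: less_imp_le)
    then have "ergodic_eq n E Vmax r (cycle_mean ?g r) (potential ?g r)"
      by (rule ergodic_eq_gap[OF g])
    moreover have "excess r (cycle_mean ?g r) (potential ?g r) i (?g i) = 0" if "i < n" for i
      using gap_self[OF g that] unfolding gap_def .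
    ultimately have "bias_induced n E Vmax r \<sigma> \<tau>" unfolding bias_induced_excess by blast
    moreover have "\<sigma>' = \<sigma> \<and> \<tau>' = \<tau>"
      if p: "policy_pair n E Vmax \<sigma>' \<tau>'" and b: "bias_induced n E Vmax r \<sigma>' \<tau>'" for \<sigma>' \<tau>'
    proof (rule policy_eqI[OF Xi_policy[OF Xi] p], rule ccontr)
      fix i assume i: "i < n" and ne: "joint \<sigma>' \<tau>' i \<noteq> ?g i"
      obtain lam v where v: "ergodic_eq n E Vmax r lam v"
        and sat: "excess r lam v i (joint \<sigma>' \<tau>' i) = 0"
        using b i unfolding bias_induced_excess by blast
      have e: "(i, joint \<sigma>' \<tau>' i) \<in> E" using policy_edge_map[OF p] i by (simp add: edge_map_def)
      have "excess r lam v i (joint \<sigma>' \<tau>' i) = gap ?g r i (joint \<sigma>' \<tau>' i)"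
        by (rule strict_gap_bias_unique[OF g _ v e]) (use R in blast)
      with R[rule_format, OF e ne] sat show False by simp
    qed
    ultimately show ?L unfolding P_set_def by blast
  }
qed

section \<open>From a point to a ball\<close>

definition gap_coeff :: "(nat \<Rightarrow> nat) \<Rightarrow> nat \<Rightarrow> nat \<Rightarrow> nat \<times> nat \<Rightarrow> real" where
  "gap_coeff g i j = (SOME a. (\<forall>r. gap g r i j = (\<Sum>e\<in>E. a e * r e)) \<and> (\<Sum>e\<in>E. \<bar>a e\<bar>) \<le> 4 * real n - 2)"

lemma gap_coeff:
  assumes "unicyclic g" "(i, j) \<in> E"
  shows gap_linear: "gap g r i j = (\<Sum>e\<in>E. gap_coeff g i j e * r e)"
    and gap_norm_le: "(\<Sum>e\<in>E. \<bar>gap_coeff g i j e\<bar>) \<le> 4 * real n - 2"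
proof -
  let ?P = "\<lambda>a. (\<forall>r. gap g r i j = (\<Sum>e\<in>E. a e * r e)) \<and> (\<Sum>e\<in>E. \<bar>a e\<bar>) \<le> 4 * real n - 2"
  have "?P (gap_coeff g i j)"
    unfolding gap_coeff_def by (rule someI_ex[OF lin_gap[OF assms, unfolded lin_def]])
  then show "gap g r i j = (\<Sum>e\<in>E. gap_coeff g i j e * r e)"
    "(\<Sum>e\<in>E. \<bar>gap_coeff g i j e\<bar>) \<le> 4 * real n - 2" by blast+
qed

text \<open>Over a ball of radius \<open>\<delta>\<close> in sup-norm, a linear form falls below its
  value at the centre by at most \<open>\<delta>\<close> times the l1-norm of its coefficients, and
  this is attained. The equivalence also turns the event into finitely many linear inequalities,
  which is how its measurability is obtained.\<close>

lemma ball_inf_subset_P_set: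
  assumes Xi: "(\<sigma>, \<tau>) \<in> Xi n E Vmax" and "0 \<le> \<delta>"
  shows "ball_inf E r \<delta> \<subseteq> P_set n E Vmax \<sigma> \<tau> \<longleftrightarrow>
    (\<forall>(i, j)\<in>{(i, j) \<in> E. j \<noteq> joint \<sigma> \<tau> i}.
       \<delta> * (\<Sum>e\<in>E. \<bar>gap_coeff (joint \<sigma> \<tau>) i j e\<bar>) < gap (joint \<sigma> \<tau>) r i j)" (is "?L \<longleftrightarrow> ?R")
proof
  let ?g = "joint \<sigma> \<tau>"
  note g = Xi_unicyclic[OF Xi]
  {
    assume L: ?L
    show ?R
    proof clarify
      fix i j assume e: "(i, j) \<in> E" "j \<noteq> ?g i"
      let ?a = "gap_coeff ?g i j"
      \<comment> \<open>The worst point of the ball for this gap: each weight is moved by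
        \<open>\<delta>\<close> against the sign of its coefficient.\<close>
      let ?r = "\<lambda>e. r e - \<delta> * sgn (?a e)"
      have "?r \<in> ball_inf E r \<delta>"
        using \<open>0 \<le> \<delta>\<close> by (auto simp: ball_inf_def abs_mult sgn_if)
      then have "0 < gap ?g ?r i j" using L P_set_gap[OF Xi] e by blast
      also have "gap ?g ?r i j = gap ?g r i j - \<delta> * (\<Sum>e\<in>E. \<bar>?a e\<bar>)"
        unfolding gap_linear[OF g e(1)] sum_distrib_left sum_subtractf[symmetric]
        by (intro sum.cong refl) (simp add: algebra_simps abs_sgn)
      finally show "\<delta> * (\<Sum>e\<in>E. \<bar>?a e\<bar>) < gap ?g r i j" by simp
    qed
  }
  {
    assume R: ?R
    show ?L
    proof
      fix r' assume r': "r' \<in> ball_inf E r \<delta>"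
      show "r' \<in> P_set n E Vmax \<sigma> \<tau>"
        unfolding P_set_gap[OF Xi]
      proof (intro allI impI)
        fix i j assume e: "(i, j) \<in> E" "j \<noteq> ?g i"
        let ?a = "gap_coeff ?g i j"
        have "gap ?g r i j - gap ?g r' i j = (\<Sum>e\<in>E. ?a e * (r e - r' e))"
          unfolding gap_linear[OF g e(1)] by (simp add: sum_subtractf right_diff_distrib)
        also have "\<dots> \<le> (\<Sum>e\<in>E. \<bar>?a e\<bar> * \<delta>)"
        proof (rule sum_mono)
          fix e assume "e \<in> E"
          have "?a e * (r e - r' e) \<le> \<bar>?a e\<bar> * \<bar>r e - r' e\<bar>"
            by (metis abs_ge_self abs_mult)
          also have "\<dots> \<le> \<bar>?a e\<bar> * \<delta>"
            using r' \<open>e \<in> E\<close> by (intro mult_left_mono) (auto simp: ball_inf_def)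
          finally show "?a e * (r e - r' e) \<le> \<bar>?a e\<bar> * \<delta>" .
        qed
        also have "\<dots> = \<delta> * (\<Sum>e\<in>E. \<bar>?a e\<bar>)" by (simp add: sum_distrib_left mult.commute)
        also have "\<dots> < gap ?g r i j" using R e by blast
        finally show "0 < gap ?g r' i j" by simp
      qed
    qed
  }
qed

section \<open>Generic weights and the isolation of a single edge\<close>

definition generic :: "(nat \<times> nat \<Rightarrow> real) \<Rightarrow> bool" where
  "generic r \<longleftrightarrow> (\<forall>\<sigma> \<tau> C D. policy_pair n E Vmax \<sigma> \<tau> \<longrightarrow>
     C \<in> func_cycles n (joint \<sigma> \<tau>) \<longrightarrow> D \<in> func_cycles n (joint \<sigma> \<tau>) \<longrightarrow> C \<noteq> D \<longrightarrow>
     real (card D) * (\<Sum>i\<in>C. r (i, joint \<sigma> \<tau> i)) \<noteq> real (card C) * (\<Sum>i\<in>D. r (i, joint \<sigma> \<tau> i)))"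

text \<open>All cycles along which a bias is tight have the same mean \<open>lam\<close>, so
  genericity leaves room for only one.\<close>

lemma generic_bias_Xi:
  assumes "generic r" and u: "ergodic_eq n E Vmax r lam u" and p: "policy_pair n E Vmax \<sigma> \<tau>"
    and sat: "\<And>i. i < n \<Longrightarrow> excess r lam u i (joint \<sigma> \<tau> i) = 0"
  shows "(\<sigma>, \<tau>) \<in> Xi n E Vmax"
proof (rule ccontr)
  let ?g = "joint \<sigma> \<tau>"
  note g = policy_edge_map[OF p]
  assume "(\<sigma>, \<tau>) \<notin> Xi n E Vmax"
  then have "card (func_cycles n ?g) \<noteq> 1" using p by (simp add: Xi_def)
  moreover obtain C where C: "C \<in> func_cycles n ?g" using func_cycles_ne[OF g] by blast
  ultimately have "func_cycles n ?g \<noteq> {C}" by auto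
  then obtain D where D: "D \<in> func_cycles n ?g" "C \<noteq> D" using C by blast
  have eq: "lam + u i = r (i, ?g i) + u (?g i)" if "i < n" for i
    using sat[OF that] by (auto simp: excess_def split: if_splits)
  have "real (card D) * (\<Sum>i\<in>C. r (i, ?g i)) = real (card C) * (\<Sum>i\<in>D. r (i, ?g i))"
    using cycle_weight[OF g C, of lam u r, OF eq] cycle_weight[OF g D(1), of lam u r, OF eq]
    by simp
  with assms(1) p C D show False unfolding generic_def by blast
qed

lemma bias_policy:
  assumes "ergodic_eq n E Vmax r lam u"
  obtains \<sigma> \<tau> where "policy_pair n E Vmax \<sigma> \<tau>"
    "\<And>i. i < n \<Longrightarrow> excess r lam u i (joint \<sigma> \<tau> i) = 0"
proof -
  obtain h where h: "\<And>i. i < n \<Longrightarrow> (i, h i) \<in> E \<and> excess r lam u i (h i) = 0"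
    using assms unfolding ergodic_eq_excess by metis
  then have "edge_map h" by (simp add: edge_map_def)
  then obtain \<sigma> \<tau> where "policy_pair n E Vmax \<sigma> \<tau>" "\<And>i. i < n \<Longrightarrow> joint \<sigma> \<tau> i = h i"
    by (rule policy_of_edge_map) blast
  with h that show thesis by simp
qed

lemma generic_bias_unique:
  assumes gen: "generic r" and u: "ergodic_eq n E Vmax r lam u" and v: "ergodic_eq n E Vmax r lam v"
    and i: "i < n"
  shows "v i - v 0 = u i - u 0"
proof (rule finite_biases_unique[OF _ _ u v i])
  let ?F = "(\<lambda>(\<sigma>, \<tau>) i. potential (joint \<sigma> \<tau>) r i - potential (joint \<sigma> \<tau>) r 0) ` Xi n E Vmax"
  show "finite ?F" using finite_Xi by simp
  fix w assume w: "ergodic_eq n E Vmax r lam w"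
  then obtain \<sigma> \<tau> where p: "policy_pair n E Vmax \<sigma> \<tau>"
    and sat: "\<And>i. i < n \<Longrightarrow> excess r lam w i (joint \<sigma> \<tau> i) = 0" by (rule bias_policy) blast
  have Xi: "(\<sigma>, \<tau>) \<in> Xi n E Vmax" using generic_bias_Xi[OF gen w p sat] .
  let ?g = "joint \<sigma> \<tau>"
  have eq: "lam + w i = r (i, ?g i) + w (?g i)" if "i < n" for i
    using sat[OF that] by (auto simp: excess_def split: if_splits)
  have "w i - w 0 = potential ?g r i - potential ?g r 0" if "i < n" for i
    using potential_unique(2)[OF Xi_unicyclic[OF Xi], of lam w r, OF eq that]
      potential_unique(2)[OF Xi_unicyclic[OF Xi], of lam w r, OF eq n_pos] by simp
  then show "\<exists>f\<in>?F. \<forall>i<n. w i - w 0 = f i"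
    using Xi by (intro bexI[OF _ image_eqI[OF refl Xi]]) simp
qed

text \<open>Formulated with the finitely many pairs in \<open>Xi\<close> instead of arbitrary
  biases: this makes it a finite combination of linear inequalities, hence measurable, and lets the
  effect of changing one weight be read off from \<open>gap_upd\<close>.\<close>

definition avoidable :: "(nat \<times> nat \<Rightarrow> real) \<Rightarrow> nat \<Rightarrow> nat \<Rightarrow> bool" where
  "avoidable r i j \<longleftrightarrow> (\<exists>(\<sigma>, \<tau>)\<in>Xi n E Vmax.
     (\<forall>(k, l)\<in>E. 0 \<le> gap (joint \<sigma> \<tau>) r k l) \<and> 0 < gap (joint \<sigma> \<tau>) r i j)"

text \<open>A positive gap means that the pair does not use the edge. Making the edge worse for the
  owner of its tail then only enlarges that one gap, so the same pair remains a witness.\<close>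

lemma avoidable_mono:
  assumes e: "(i, j) \<in> E" and av: "avoidable (r((i, j) := x)) i j" and le: "side i * y \<le> side i * x"
  shows "avoidable (r((i, j) := y)) i j"
proof -
  obtain \<sigma> \<tau> where Xi: "(\<sigma>, \<tau>) \<in> Xi n E Vmax"
    and ge: "\<And>k l. (k, l) \<in> E \<Longrightarrow> 0 \<le> gap (joint \<sigma> \<tau>) (r((i, j) := x)) k l"
    and gr: "0 < gap (joint \<sigma> \<tau>) (r((i, j) := x)) i j"
    using av unfolding avoidable_def by fast
  let ?g = "joint \<sigma> \<tau>"
  note g = Xi_unicyclic[OF Xi]
  have ne: "?g i \<noteq> j" using gr gap_self[OF g] edge_less[OF e] by force
  have upd: "gap ?g (r((i, j) := x)) k l \<le> gap ?g (r((i, j) := y)) k l" if "(k, l) \<in> E" for k l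
    using gap_upd[OF g that refl ne, of "r((i, j) := x)" y] le by (auto split: if_splits)
  have "0 \<le> gap ?g (r((i, j) := y)) k l" if "(k, l) \<in> E" for k l
    using order_trans[OF ge[OF that] upd[OF that]] .
  moreover have "0 < gap ?g (r((i, j) := y)) i j" using less_le_trans[OF gr upd[OF e]] .
  ultimately show ?thesis unfolding avoidable_def using Xi by blast
qed

lemma generic_large_gaps:
  assumes gen: "generic r" and u: "ergodic_eq n E Vmax r lam u" and "0 < w"
    and far: "\<And>i j. (i, j) \<in> E \<Longrightarrow> avoidable (r((i, j) := r (i, j) - side i * w)) i j \<Longrightarrow>
      avoidable (r((i, j) := r (i, j) + side i * w)) i j"
  shows "\<exists>(\<sigma>, \<tau>)\<in>Xi n E Vmax. \<forall>(i, j)\<in>{(i, j) \<in> E. j \<noteq> joint \<sigma> \<tau> i}. w < gap (joint \<sigma> \<tau>) r i j"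
proof -
  obtain \<sigma> \<tau> where p: "policy_pair n E Vmax \<sigma> \<tau>"
    and sat: "\<And>i. i < n \<Longrightarrow> excess r lam u i (joint \<sigma> \<tau> i) = 0" using u by (rule bias_policy) blast
  let ?g = "joint \<sigma> \<tau>"
  have Xi: "(\<sigma>, \<tau>) \<in> Xi n E Vmax" using generic_bias_Xi[OF gen u p sat] .
  note g = Xi_unicyclic[OF Xi]
  have gap_u: "gap ?g r i j = excess r lam u i j" if "(i, j) \<in> E" for i j
    using gap_eq_excess[OF g sat that] .
  have gap_ge: "0 \<le> gap ?g r i j" if "(i, j) \<in> E" for i j
    using u that edge_less[OF that] unfolding gap_u[OF that] ergodic_eq_excess by blast
  have "w < gap ?g r i j" if e: "(i, j) \<in> E" "j \<noteq> ?g i" for i j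
  proof -
    let ?r = "r((i, j) := r (i, j) - side i * w)" and ?r' = "r((i, j) := r (i, j) + side i * w)"
    have "gap ?g ?r k l = gap ?g r k l + (if (k, l) = (i, j) then w else 0)" if "(k, l) \<in> E" for k l
      using gap_upd[OF g that refl, of i j r] e by auto
    then have "avoidable ?r i j"
      unfolding avoidable_def using gap_ge e(1) \<open>0 < w\<close>
      by (intro bexI[OF _ Xi]) (auto intro!: add_nonneg_pos)
    from far[OF e(1) this] obtain \<sigma>' \<tau>' where Xi': "(\<sigma>', \<tau>') \<in> Xi n E Vmax"
      and ge: "\<And>k l. (k, l) \<in> E \<Longrightarrow> 0 \<le> gap (joint \<sigma>' \<tau>') ?r' k l"
      and gr: "0 < gap (joint \<sigma>' \<tau>') ?r' i j"
      unfolding avoidable_def by fast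
    let ?h = "joint \<sigma>' \<tau>'"
    note h = Xi_unicyclic[OF Xi']
    have ne: "?h i \<noteq> j" using gr gap_self[OF h] edge_less[OF e(1)] by force
    \<comment> \<open>\<open>?h\<close> does not use the edge, so restoring the weight adds exactly
      \<open>w\<close> to the gap of this edge and leaves the other gaps alone.\<close>
    have upd: "gap ?h r k l = gap ?h ?r' k l + (if (k, l) = (i, j) then w else 0)"
      if "(k, l) \<in> E" for k l
      using gap_upd[OF h that refl ne, of r "r (i, j) + side i * w"] by (auto split: if_splits)
    have "0 \<le> gap ?h r k l" if "(k, l) \<in> E" for k l
      using upd[OF that] ge[OF that] \<open>0 < w\<close> by simp
    then have sol: "ergodic_eq n E Vmax r (cycle_mean ?h r) (potential ?h r)"
      by (rule ergodic_eq_gap[OF h])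
    have mean: "cycle_mean ?h r = lam" using ergodic_eq_value_unique[OF u sol] .
    \<comment> \<open>Here the two pairs meet: both yield biases for the same generic
      \<open>r\<close>, so potential differences agree although the pairs may not.\<close>
    have "potential ?h r i - potential ?h r j = u i - u j"
      using generic_bias_unique[OF gen u sol[unfolded mean], of i]
        generic_bias_unique[OF gen u sol[unfolded mean], of j] edge_less[OF e(1)] by simp
    then have "gap ?h r i j = excess r lam u i j"
      unfolding gap_def mean excess_def by (simp add: algebra_simps)
    with upd[OF e(1)] gr show ?thesis unfolding gap_u[OF e(1)] by simp
  qed
  then show ?thesis using Xi by blast
qed

end

section \<open>Random weights\<close>

text \<open>Working with the diameter avoids naming the endpoint of the half-line of avoidable
  weights; the set lies in an interval of length \<open>l\<close> starting at its infimum.\<close>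

lemma emeasure_lborel_diameter_le:
  fixes Z :: "real set"
  assumes diam: "\<And>x y. x \<in> Z \<Longrightarrow> y \<in> Z \<Longrightarrow> x - y \<le> l" and "0 \<le> l"
  shows "emeasure lborel Z \<le> ennreal l"
proof (cases "Z = {}")
  case False
  then obtain z where z: "z \<in> Z" by blast
  have bdd: "bdd_below Z" using diam[OF z] by (intro bdd_belowI[of _ "z - l"]) (simp add: algebra_simps)
  have "Z \<subseteq> {Inf Z..Inf Z + l}"
  proof
    fix x assume x: "x \<in> Z"
    have "x - l \<le> Inf Z" using False diam[OF x] by (intro cInf_greatest) (auto simp: algebra_simps)
    then show "x \<in> {Inf Z..Inf Z + l}" using cInf_lower[OF x bdd] by simp
  qed
  then have "emeasure lborel Z \<le> emeasure lborel {Inf Z..Inf Z + l}" by (intro emeasure_mono) auto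
  then show ?thesis using \<open>0 \<le> l\<close> by simp
qed simp

text \<open>Fubini: condition on all coordinates but \<open>e\<close>.\<close>
lemma (in prob_space) prob_thin_section_le:
  fixes X :: "'i \<Rightarrow> 'a \<Rightarrow> real" and f :: "real \<Rightarrow> real"
  assumes fin: "finite I" and e: "e \<in> I"
    and indep: "indep_vars (\<lambda>_. borel) X I"
    and dens: "distributed M lborel (X e) (\<lambda>y. ennreal (f y))"
    and f_le: "\<And>y. f y \<le> \<phi>" and "0 \<le> \<phi>"
    and B: "{r \<in> space (Pi\<^sub>M I (\<lambda>_. borel)). Q r} \<in> sets (Pi\<^sub>M I (\<lambda>_. borel))"
    and diam: "\<And>r x y. Q (r(e := x)) \<Longrightarrow> Q (r(e := y)) \<Longrightarrow> x - y \<le> l" and "0 \<le> l"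
  shows "{\<omega> \<in> space M. Q (\<lambda>i\<in>I. X i \<omega>)} \<in> events"
    and "prob {\<omega> \<in> space M. Q (\<lambda>i\<in>I. X i \<omega>)} \<le> \<phi> * l"
proof -
  let ?B = "{r \<in> space (Pi\<^sub>M I (\<lambda>_. borel)). Q r}"
  let ?Y = "\<lambda>\<omega>. \<lambda>i\<in>I. X i \<omega>"
  have rv: "\<And>i. i \<in> I \<Longrightarrow> random_variable borel (X i)" using indep by (auto simp: indep_vars_def)
  then have Y: "?Y \<in> measurable M (Pi\<^sub>M I (\<lambda>_. borel))" by (intro measurable_restrict) auto
  have eq: "{\<omega> \<in> space M. Q (?Y \<omega>)} = ?Y -` ?B \<inter> space M"
    using measurable_space[OF Y] by auto
  show ev: "{\<omega> \<in> space M. Q (?Y \<omega>)} \<in> events"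
    unfolding eq by (rule measurable_sets[OF Y B])
  \<comment> \<open>The point mass outside \<open>I\<close> is a default value: the product locale
    asks for a sigma-finite measure at every index.\<close>
  define N where "N i = (if i \<in> I then distr M borel (X i) else return borel (0::real))" for i
  have N_prob: "prob_space (N i)" for i
    unfolding N_def by (auto intro!: prob_space_distr rv prob_space_return)
  interpret N: product_sigma_finite N
    unfolding product_sigma_finite_def using N_prob by (simp add: prob_space_imp_sigma_finite)
  have sets_N: "sets (N i) = sets borel" for i by (simp add: N_def)
  have sets_PN: "sets (Pi\<^sub>M J N) = sets (Pi\<^sub>M J (\<lambda>_. borel))" for J
    by (rule sets_PiM_cong) (simp_all add: sets_N)
  have I: "insert e (I - {e}) = I" using e by blast
  have distr_eq: "distr M (Pi\<^sub>M I (\<lambda>_. borel)) ?Y = Pi\<^sub>M I N"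
  proof -
    have "distr M (Pi\<^sub>M I (\<lambda>_. borel)) ?Y = Pi\<^sub>M I (\<lambda>i. distr M borel (X i))"
      using indep_vars_iff_distr_eq_PiM'[where X = X and I = I and M' = "\<lambda>_. borel"] e rv indep by auto
    also have "\<dots> = Pi\<^sub>M I N" by (rule PiM_cong) (auto simp: N_def)
    finally show ?thesis .
  qed
  have dist_e: "N e = density lborel (\<lambda>y. ennreal (f y))"
  proof -
    have "N e = distr M borel (X e)" unfolding N_def using e by simp
    also have "\<dots> = distr M lborel (X e)" by (rule distr_cong) simp_all
    finally have "N e = distr M lborel (X e)" .
    then show ?thesis using distributed_distr_eq_density[OF dens] by simp
  qed
  have f_meas: "(\<lambda>y. ennreal (f y)) \<in> borel_measurable lborel"
    using distributed_borel_measurable[OF dens] .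
  have slice: "(\<integral>\<^sup>+y. indicator ?B (r(e := y)) \<partial>N e) \<le> ennreal (\<phi> * l)"
    if r: "r \<in> space (Pi\<^sub>M (I - {e}) N)" for r
  proof -
    have "(\<lambda>y. r(e := y)) \<in> measurable borel (Pi\<^sub>M (insert e (I - {e})) (\<lambda>_. borel))"
    proof (rule measurable_fun_upd[where J = "I - {e}"])
      show "(\<lambda>y. r) \<in> measurable borel (Pi\<^sub>M (I - {e}) (\<lambda>_. borel))"
        using r sets_eq_imp_space_eq[OF sets_PN] by auto
    qed auto
    then have upd: "(\<lambda>y. r(e := y)) \<in> measurable borel (Pi\<^sub>M I (\<lambda>_. borel))" unfolding I .
    let ?Z = "(\<lambda>y. r(e := y)) -` ?B \<inter> space borel"
    have Z: "?Z \<in> sets borel" by (rule measurable_sets[OF upd B])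
    have ind: "indicator ?B (r(e := y)) = (indicator ?Z y :: ennreal)" for y
      by (simp add: indicator_def)
    have "(\<integral>\<^sup>+y. indicator ?B (r(e := y)) \<partial>N e) = (\<integral>\<^sup>+y. ennreal (f y) * indicator ?Z y \<partial>lborel)"
      unfolding dist_e ind using Z by (intro nn_integral_density f_meas) auto
    also have "\<dots> \<le> (\<integral>\<^sup>+y. ennreal \<phi> * indicator ?Z y \<partial>lborel)"
      using f_le by (intro nn_integral_mono mult_right_mono) (auto intro: ennreal_leI)
    also have "\<dots> = ennreal \<phi> * emeasure lborel ?Z"
      using Z by (intro nn_integral_cmult_indicator) auto
    also have "\<dots> \<le> ennreal \<phi> * ennreal l"
      by (intro mult_left_mono emeasure_lborel_diameter_le) (use diam \<open>0 \<le> l\<close> in auto)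
    also have "\<dots> = ennreal (\<phi> * l)" using \<open>0 \<le> \<phi>\<close> \<open>0 \<le> l\<close> by (simp add: ennreal_mult)
    finally show ?thesis .
  qed
  have B': "?B \<in> sets (Pi\<^sub>M (insert e (I - {e})) N)" unfolding I sets_PN by (rule B)
  interpret PN: prob_space "Pi\<^sub>M (I - {e}) N" by (rule prob_space_PiM) (rule N_prob)
  have "emeasure M {\<omega> \<in> space M. Q (?Y \<omega>)} = emeasure (distr M (Pi\<^sub>M I (\<lambda>_. borel)) ?Y) ?B"
    unfolding eq by (rule emeasure_distr[OF Y B, symmetric])
  also have "\<dots> = (\<integral>\<^sup>+r. indicator ?B r \<partial>Pi\<^sub>M (insert e (I - {e})) N)"
    unfolding distr_eq using nn_integral_indicator[OF B'] unfolding I by (rule sym)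
  also have "\<dots> = (\<integral>\<^sup>+r. (\<integral>\<^sup>+y. indicator ?B (r(e := y)) \<partial>N e) \<partial>Pi\<^sub>M (I - {e}) N)"
    using fin B' by (intro N.product_nn_integral_insert) auto
  also have "\<dots> \<le> (\<integral>\<^sup>+r. ennreal (\<phi> * l) \<partial>Pi\<^sub>M (I - {e}) N)"
    by (rule nn_integral_mono) (rule slice)
  also have "\<dots> = ennreal (\<phi> * l)" by (simp add: PN.emeasure_space_1)
  finally show "prob {\<omega> \<in> space M. Q (?Y \<omega>)} \<le> \<phi> * l"
    using \<open>0 \<le> \<phi>\<close> \<open>0 \<le> l\<close> by (simp add: emeasure_eq_measure)
qed

context game
begin

section \<open>Measurability of the events\<close>

lemma borel_measurable_gap:
  assumes g: "unicyclic g" and e: "(i, j) \<in> E"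
    and F: "\<And>e. e \<in> E \<Longrightarrow> (\<lambda>\<omega>. F \<omega> e) \<in> borel_measurable N"
  shows "(\<lambda>\<omega>. gap g (F \<omega>) i j) \<in> borel_measurable N"
  unfolding gap_linear[OF g e] by (intro borel_measurable_sum borel_measurable_times F) auto

text \<open>The weights enter through an arbitrary measurable \<open>F\<close>, so that the lemma
  applies to the coordinates of the product space with one of them shifted.\<close>

lemma sets_avoidable:
  assumes e: "(i, j) \<in> E" and F: "\<And>e. e \<in> E \<Longrightarrow> (\<lambda>\<omega>. F \<omega> e) \<in> borel_measurable N"
  shows "{\<omega> \<in> space N. avoidable (F \<omega>) i j} \<in> sets N"
  unfolding avoidable_def
proof (rule sets.sets_Collect_finite_Ex[OF _ finite_Xi], clarify)
  fix \<sigma> \<tau> assume "(\<sigma>, \<tau>) \<in> Xi n E Vmax"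
  then have g: "unicyclic (joint \<sigma> \<tau>)" by (rule Xi_unicyclic)
  have "{\<omega> \<in> space N. \<forall>(k, l)\<in>E. 0 \<le> gap (joint \<sigma> \<tau>) (F \<omega>) k l} \<in> sets N"
    by (rule sets.sets_Collect_finite_All[OF _ finite_E], clarify)
       (intro borel_measurable_le borel_measurable_const borel_measurable_gap[OF g] F)
  moreover have "{\<omega> \<in> space N. 0 < gap (joint \<sigma> \<tau>) (F \<omega>) i j} \<in> sets N"
    by (intro borel_measurable_less borel_measurable_const borel_measurable_gap[OF g e] F)
  ultimately show "{\<omega> \<in> space N. (\<forall>(k, l)\<in>E. 0 \<le> gap (joint \<sigma> \<tau>) (F \<omega>) k l) \<and>
      0 < gap (joint \<sigma> \<tau>) (F \<omega>) i j} \<in> sets N"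
    by (intro sets.sets_Collect_conj)
qed

lemma sets_ball_inf_subset_P_set:
  assumes F: "\<And>e. e \<in> E \<Longrightarrow> (\<lambda>\<omega>. F \<omega> e) \<in> borel_measurable N" and "0 \<le> \<delta>"
  shows "{\<omega> \<in> space N. \<exists>(\<sigma>, \<tau>)\<in>Xi n E Vmax. ball_inf E (F \<omega>) \<delta> \<subseteq> P_set n E Vmax \<sigma> \<tau>} \<in> sets N"
proof (rule sets.sets_Collect_finite_Ex[OF _ finite_Xi], clarify)
  fix \<sigma> \<tau> assume Xi: "(\<sigma>, \<tau>) \<in> Xi n E Vmax"
  then have g: "unicyclic (joint \<sigma> \<tau>)" by (rule Xi_unicyclic)
  have fin: "finite {(i, j) \<in> E. j \<noteq> joint \<sigma> \<tau> i}"
    using finite_E by (rule rev_finite_subset) auto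
  show "{\<omega> \<in> space N. ball_inf E (F \<omega>) \<delta> \<subseteq> P_set n E Vmax \<sigma> \<tau>} \<in> sets N"
    unfolding ball_inf_subset_P_set[OF Xi \<open>0 \<le> \<delta>\<close>]
    by (rule sets.sets_Collect_finite_All[OF _ fin], clarify)
       (intro borel_measurable_less borel_measurable_const borel_measurable_gap[OF g] F)
qed

end

section \<open>Probabilities of the exceptional events\<close>

locale random_game = game + prob_space M
  for M :: "'a measure" +
  fixes X :: "nat \<times> nat \<Rightarrow> 'a \<Rightarrow> real" and f :: "nat \<times> nat \<Rightarrow> real \<Rightarrow> real" and \<phi> :: real
  assumes indep: "indep_vars (\<lambda>_. borel) X E"
    and dens: "\<And>e. e \<in> E \<Longrightarrow> distributed M lborel (X e) (\<lambda>y. ennreal (f e y))"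
    and \<phi>_pos: "0 < \<phi>"
    and f_le: "\<And>e y. e \<in> E \<Longrightarrow> f e y \<le> \<phi>"
begin

abbreviation weights :: "'a \<Rightarrow> nat \<times> nat \<Rightarrow> real" where
  "weights \<omega> \<equiv> (\<lambda>e\<in>E. X e \<omega>)"

lemmas thin_section = prob_thin_section_le[OF finite_E _ indep dens f_le less_imp_le[OF \<phi>_pos]]

lemma coordinate_measurable:
  "e \<in> E \<Longrightarrow> (\<lambda>r. r e) \<in> borel_measurable (Pi\<^sub>M E (\<lambda>_. borel :: real measure))"
  by (rule measurable_component_singleton)

text \<open>Distinct cycles are disjoint, so the weight of an edge of \<open>C\<close> occurs on the
  left side only, with coefficient \<open>card D > 0\<close>. With the other weights fixed, at most
  one value satisfies the equation: a section of diameter 0.\<close>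

lemma equal_means_null:
  assumes g: "edge_map g" and C: "C \<in> func_cycles n g" and D: "D \<in> func_cycles n g" and "C \<noteq> D"
  defines "Q \<equiv> \<lambda>r. real (card D) * (\<Sum>i\<in>C. r (i, g i)) = real (card C) * (\<Sum>i\<in>D. r (i, g i))"
  shows "{\<omega> \<in> space M. Q (weights \<omega>)} \<in> events" and "prob {\<omega> \<in> space M. Q (weights \<omega>)} = 0"
proof -
  have disj: "C \<inter> D = {}" using cycle_eq_orbit[OF C] cycle_eq_orbit[OF D] \<open>C \<noteq> D\<close> by blast
  note C_props = cycle_props[OF g C] and D_props = cycle_props[OF g D]
  obtain i where i: "i \<in> C" using C_props(2) by blast
  have fin: "finite C" "finite D" using C_props(1) D_props(1) finite_subset by blast+
  have edge: "(k, g k) \<in> E" if "k \<in> C \<union> D" for k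
    using g that C_props(1) D_props(1) by (auto simp: edge_map_def)
  have e: "(i, g i) \<in> E" using edge i by blast
  have meas: "{r \<in> space (Pi\<^sub>M E (\<lambda>_. borel)). Q r} \<in> sets (Pi\<^sub>M E (\<lambda>_. borel))"
    unfolding Q_def using edge
    by (intro borel_measurable_eq borel_measurable_times borel_measurable_sum
        borel_measurable_const coordinate_measurable) auto
  have diam: "x - y \<le> 0" if "Q (r((i, g i) := x))" "Q (r((i, g i) := y))" for r x y
  proof -
    have sum_C: "(\<Sum>k\<in>C. (r((i, g i) := z)) (k, g k)) = z + (\<Sum>k\<in>C - {i}. r (k, g k))" for z
      using fin(1) i by (subst sum.remove[of C i]) auto
    have sum_D: "(\<Sum>k\<in>D. (r((i, g i) := z)) (k, g k)) = (\<Sum>k\<in>D. r (k, g k))" for z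
      using i disj by (intro sum.cong) auto
    have "real (card D) * x = real (card D) * y"
      using that unfolding Q_def sum_C sum_D distrib_left by linarith
    then show ?thesis using fin(2) D_props(2) by (simp add: card_gt_0_iff)
  qed
  show "{\<omega> \<in> space M. Q (weights \<omega>)} \<in> events"
    by (rule thin_section(1)[OF e e e meas diam order.refl])
  show "prob {\<omega> \<in> space M. Q (weights \<omega>)} = 0"
    using thin_section(2)[OF e e e meas diam order.refl]
    by (intro antisym measure_nonneg) simp
qed

text \<open>The switch from avoidable to not avoidable takes place within \<open>w\<close> of the
  current weight; this is the negation of the hypothesis \<open>far\<close> in
  \<open>generic_large_gaps\<close>.\<close>

definition near_threshold :: "real \<Rightarrow> nat \<Rightarrow> nat \<Rightarrow> (nat \<times> nat \<Rightarrow> real) \<Rightarrow> bool" where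
  "near_threshold w i j r \<longleftrightarrow> avoidable (r((i, j) := r (i, j) - side i * w)) i j \<and>
     \<not> avoidable (r((i, j) := r (i, j) + side i * w)) i j"

lemma near_threshold_prob:
  assumes e: "(i, j) \<in> E" and "0 \<le> w"
  shows "{\<omega> \<in> space M. near_threshold w i j (weights \<omega>)} \<in> events"
    and "prob {\<omega> \<in> space M. near_threshold w i j (weights \<omega>)} \<le> \<phi> * (2 * w)"
proof -
  let ?P = "Pi\<^sub>M E (\<lambda>_. borel :: real measure)"
  have upd: "(\<lambda>r. (r((i, j) := r (i, j) + c)) e') \<in> borel_measurable ?P" if "e' \<in> E" for c e'
    using coordinate_measurable[OF that] coordinate_measurable[OF e]
    by (cases "e' = (i, j)") (auto intro: borel_measurable_add)
  have "{r \<in> space ?P. near_threshold w i j r} \<in> sets ?P"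
    unfolding near_threshold_def
    using sets_avoidable[OF e, of "\<lambda>r. r((i, j) := r (i, j) + (- (side i * w)))" ?P, OF upd]
      sets_avoidable[OF e, of "\<lambda>r. r((i, j) := r (i, j) + side i * w)" ?P, OF upd]
    by (intro sets.sets_Collect_conj sets.sets_Collect_neg) simp_all
  moreover have "x - y \<le> 2 * w"
    if x: "near_threshold w i j (r((i, j) := x))" and y: "near_threshold w i j (r((i, j) := y))"
    for r x y
  proof -
    \<comment> \<open>If \<open>x\<close> and \<open>y\<close> were \<open>2 w\<close> or more
      apart, monotonicity would carry avoidability from the worsened weight of one to the improved
      weight of the other. Both orders are needed because the direction of the half-line depends on
      the player.\<close>
    have "\<not> side i * (y + side i * w) \<le> side i * (x - side i * w)"
      "\<not> side i * (x + side i * w) \<le> side i * (y - side i * w)"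
      using avoidable_mono[OF e, of r "x - side i * w" "y + side i * w"]
        avoidable_mono[OF e, of r "y - side i * w" "x + side i * w"] x y
      unfolding near_threshold_def fun_upd_same fun_upd_upd by blast+
    then show ?thesis by (auto split: if_splits)
  qed
  ultimately show "{\<omega> \<in> space M. near_threshold w i j (weights \<omega>)} \<in> events"
    "prob {\<omega> \<in> space M. near_threshold w i j (weights \<omega>)} \<le> \<phi> * (2 * w)"
    using thin_section[OF e e e, of "near_threshold w i j" "2 * w"] \<open>0 \<le> w\<close> by auto
qed

lemma prob_robust_policy:
  assumes erg: "ergodic_graph n E Vmax" and "0 < \<delta>"
  shows "prob {\<omega> \<in> space M. \<exists>(\<sigma>, \<tau>)\<in>Xi n E Vmax.
           ball_inf E (\<lambda>e. X e \<omega>) \<delta> \<subseteq> P_set n E Vmax \<sigma> \<tau>}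
         \<ge> 1 - 4 * (2 * real n + 1) * real (card E) * \<phi> * \<delta>"
proof -
  let ?G = "{\<omega> \<in> space M. \<exists>(\<sigma>, \<tau>)\<in>Xi n E Vmax.
    ball_inf E (\<lambda>e. X e \<omega>) \<delta> \<subseteq> P_set n E Vmax \<sigma> \<tau>}"
  \<comment> \<open>Large enough to absorb the loss of at most \<open>(4 n - 2) \<delta>\<close> on
    the ball, and such that \<open>card E\<close> windows cost \<open>2 \<phi> w * card E\<close>,
    the bound claimed.\<close>
  define w where "w = (4 * real n + 2) * \<delta>"
  have w_pos: "0 < w" unfolding w_def using \<open>0 < \<delta>\<close> by (simp add: add_pos_pos)
  define T where "T = {((\<sigma>, \<tau>), (C, D)). policy_pair n E Vmax \<sigma> \<tau> \<and>
    C \<in> func_cycles n (joint \<sigma> \<tau>) \<and> D \<in> func_cycles n (joint \<sigma> \<tau>) \<and> C \<noteq> D}"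
  define H where "H = (\<lambda>((\<sigma>, \<tau>), (C, D)). {\<omega> \<in> space M.
    real (card D) * (\<Sum>i\<in>C. weights \<omega> (i, joint \<sigma> \<tau> i)) =
    real (card C) * (\<Sum>i\<in>D. weights \<omega> (i, joint \<sigma> \<tau> i))})"
  define B where "B = (\<lambda>(i, j). {\<omega> \<in> space M. near_threshold w i j (weights \<omega>)})"
  have fin_T: "finite T"
  proof (rule finite_subset)
    show "T \<subseteq> {(\<sigma>, \<tau>). policy_pair n E Vmax \<sigma> \<tau>} \<times> (Pow {..<n} \<times> Pow {..<n})"
      unfolding T_def using cycle_props(1)[OF policy_edge_map] by auto
    show "finite ({(\<sigma>, \<tau>). policy_pair n E Vmax \<sigma> \<tau>} \<times> (Pow {..<n} \<times> Pow {..<n}))"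
      using finite_policies by simp
  qed
  have H: "H t \<in> events" "prob (H t) = 0" if "t \<in> T" for t
  proof -
    from that obtain \<sigma> \<tau> C D where t: "t = ((\<sigma>, \<tau>), (C, D))" "policy_pair n E Vmax \<sigma> \<tau>"
      "C \<in> func_cycles n (joint \<sigma> \<tau>)" "D \<in> func_cycles n (joint \<sigma> \<tau>)" "C \<noteq> D"
      unfolding T_def by blast
    show "H t \<in> events" "prob (H t) = 0"
      unfolding t(1) H_def prod.case
      by (rule equal_means_null[OF policy_edge_map[OF t(2)] t(3-5)])+
  qed
  have B: "B e \<in> events" "prob (B e) \<le> \<phi> * (2 * w)" if "e \<in> E" for e
    using that near_threshold_prob[of "fst e" "snd e" w] w_pos
    unfolding B_def case_prod_beta by simp_all
  have rv: "X e \<in> borel_measurable M" if "e \<in> E" for e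
    using distributed_measurable[OF dens[OF that]] by simp
  have G: "?G \<in> events"
    using sets_ball_inf_subset_P_set[of "\<lambda>\<omega> e. X e \<omega>" M \<delta>] rv \<open>0 < \<delta>\<close> by simp
  \<comment> \<open>Outside the null events the weights are generic, and outside the windows
    \<open>generic_large_gaps\<close> applies.\<close>
  have "space M - ?G \<subseteq> (\<Union>t\<in>T. H t) \<union> (\<Union>e\<in>E. B e)"
  proof
    fix \<omega> assume \<omega>: "\<omega> \<in> space M - ?G"
    show "\<omega> \<in> (\<Union>t\<in>T. H t) \<union> (\<Union>e\<in>E. B e)"
    proof (rule ccontr)
      assume "\<omega> \<notin> (\<Union>t\<in>T. H t) \<union> (\<Union>e\<in>E. B e)"
      then have notH: "\<And>t. t \<in> T \<Longrightarrow> \<omega> \<notin> H t" and notB: "\<And>e. e \<in> E \<Longrightarrow> \<omega> \<notin> B e" by auto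
      have gen: "generic (weights \<omega>)"
        unfolding generic_def
      proof (intro allI impI)
        fix \<sigma> \<tau> C D
        assume "policy_pair n E Vmax \<sigma> \<tau>" "C \<in> func_cycles n (joint \<sigma> \<tau>)"
          "D \<in> func_cycles n (joint \<sigma> \<tau>)" "C \<noteq> D"
        then have "((\<sigma>, \<tau>), (C, D)) \<in> T" by (simp add: T_def)
        from notH[OF this] \<omega>
        show "real (card D) * (\<Sum>i\<in>C. weights \<omega> (i, joint \<sigma> \<tau> i)) \<noteq>
            real (card C) * (\<Sum>i\<in>D. weights \<omega> (i, joint \<sigma> \<tau> i))"
          unfolding H_def prod.case by blast
      qed
      obtain lam u where u: "ergodic_eq n E Vmax (weights \<omega>) lam u"
        using erg unfolding ergodic_graph_def by blast
      obtain \<sigma> \<tau> where Xi: "(\<sigma>, \<tau>) \<in> Xi n E Vmax"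
        and gap: "\<And>i j. (i, j) \<in> E \<Longrightarrow> j \<noteq> joint \<sigma> \<tau> i \<Longrightarrow> w < gap (joint \<sigma> \<tau>) (weights \<omega>) i j"
      proof -
        have "avoidable ((weights \<omega>)((i, j) := weights \<omega> (i, j) + side i * w)) i j"
          if "(i, j) \<in> E"
            "avoidable ((weights \<omega>)((i, j) := weights \<omega> (i, j) - side i * w)) i j" for i j
          using notB[OF that(1)] that(2) \<omega> unfolding B_def near_threshold_def prod.case by blast
        from generic_large_gaps[OF gen u w_pos this] that show thesis by blast
      qed
      have "ball_inf E (weights \<omega>) \<delta> \<subseteq> P_set n E Vmax \<sigma> \<tau>"
        unfolding ball_inf_subset_P_set[OF Xi less_imp_le[OF \<open>0 < \<delta>\<close>]]
      proof clarify
        fix i j assume e: "(i, j) \<in> E" "j \<noteq> joint \<sigma> \<tau> i"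
        have "\<delta> * (\<Sum>e\<in>E. \<bar>gap_coeff (joint \<sigma> \<tau>) i j e\<bar>) \<le> \<delta> * (4 * real n - 2)"
          using gap_norm_le[OF Xi_unicyclic[OF Xi] e(1)] \<open>0 < \<delta>\<close> by (intro mult_left_mono) auto
        also have "\<dots> \<le> w" unfolding w_def using \<open>0 < \<delta>\<close> by (simp add: algebra_simps)
        also have "\<dots> < gap (joint \<sigma> \<tau>) (weights \<omega>) i j" using gap[OF e] .
        finally show "\<delta> * (\<Sum>e\<in>E. \<bar>gap_coeff (joint \<sigma> \<tau>) i j e\<bar>) < gap (joint \<sigma> \<tau>) (weights \<omega>) i j" .
      qed
      moreover have "ball_inf E (weights \<omega>) \<delta> = ball_inf E (\<lambda>e. X e \<omega>) \<delta>"
        by (simp add: ball_inf_def)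
      ultimately show False using \<omega> Xi by blast
    qed
  qed
  moreover have events: "(\<Union>t\<in>T. H t) \<in> events" "(\<Union>e\<in>E. B e) \<in> events"
    by (intro sets.finite_UN fin_T finite_E H(1) B(1); assumption)+
  ultimately have "prob (space M - ?G) \<le> prob ((\<Union>t\<in>T. H t) \<union> (\<Union>e\<in>E. B e))"
    by (intro finite_measure_mono sets.Un)
  also have "\<dots> \<le> prob (\<Union>t\<in>T. H t) + prob (\<Union>e\<in>E. B e)"
    by (rule measure_Un_le[OF events])
  also have "\<dots> \<le> (\<Sum>t\<in>T. prob (H t)) + (\<Sum>e\<in>E. prob (B e))"
    by (intro add_mono finite_measure_subadditive_finite fin_T finite_E image_subsetI H(1) B(1))
  also have "\<dots> \<le> 0 + (\<Sum>e\<in>E. \<phi> * (2 * w))"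
    using H(2) B(2) by (intro add_mono sum_mono) auto
  also have "\<dots> = 4 * (2 * real n + 1) * real (card E) * \<phi> * \<delta>"
    unfolding w_def by (simp add: algebra_simps)
  finally show ?thesis using prob_compl[OF G] by linarith
qed

end

theorem mainTheorem14:
  fixes n :: nat and E :: "(nat \<times> nat) set" and Vmax :: "nat set"
    and M :: "'a measure" and X :: "nat \<times> nat \<Rightarrow> 'a \<Rightarrow> real"
    and f :: "nat \<times> nat \<Rightarrow> real \<Rightarrow> real" and \<phi> :: real
  assumes "n \<ge> 1"
    and "game_graph n E Vmax"
    and "ergodic_graph n E Vmax"
    and "prob_space M"
    and "prob_space.indep_vars M (\<lambda>_. borel) X E"
    and "\<And>e. e \<in> E \<Longrightarrow> distributed M lborel (X e) (\<lambda>y. ennreal (f e y))"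
    and "\<phi> > 0"
    and "\<And>e y. e \<in> E \<Longrightarrow> f e y \<le> \<phi>"
  shows "measure M {\<omega> \<in> space M. \<exists>(\<sigma>, \<tau>) \<in> Xi n E Vmax.
            ball_inf E (\<lambda>e. X e \<omega>) (1 / (4 * real n * (2 * real n + 1) * real (card E) * \<phi>))
              \<subseteq> P_set n E Vmax \<sigma> \<tau>}
         \<ge> 1 - 1 / real n"
proof -
  interpret prob_space M by fact
  interpret random_game n E Vmax M X f \<phi>
    by unfold_locales (use assms in auto)
  let ?\<delta> = "1 / (4 * real n * (2 * real n + 1) * real (card E) * \<phi>)"
  \<comment> \<open>Without an edge the quotient would be 0 by convention; the edge leaving a vertex
    rules this out.\<close>
  have "0 < card E" using ex_succ[OF n_pos] finite_E by (auto simp: card_gt_0_iff)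
  then have "0 < ?\<delta>" using n_pos \<phi>_pos by (intro divide_pos_pos mult_pos_pos) auto
  moreover have "4 * (2 * real n + 1) * real (card E) * \<phi> * ?\<delta> = 1 / real n"
    using \<open>0 < card E\<close> n_pos \<phi>_pos by (simp add: divide_simps)
  ultimately show ?thesis using prob_robust_policy[OF assms(3), of ?\<delta>] by simp
qed

end
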